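(* Let $\mathbb K$ be a field. For every integer $s\ge 4$ there is a finite simple co-chordal graph $G$ such that the symbolic power $I(G)^{(s)}$ of its edge ideal (in the polynomial ring over $\mathbb K$ with one variable for each vertex of $G$) is not componentwise linear. More precisely, the ideal generated by the degree $s+2$ component of $I(G)^{(s)}$ has Castelnuovo--Mumford regularity at least $s+3$.
   Context: A graph is chordal if it has no induced cycle of length at least $4$; $G$ is co-chordal if its complement $G^c$ is chordal. For a finite simple graph $G$ on $[n]=\{1,\dots,n\}$ and the standard graded ring $S=\mathbb K[x_1,\dots,x_n]$, the edge ideal is $I(G)=(x_ix_j:\{i,j\}\in E(G))$, and $I(G)^{(s)}=\bigcap_{C}P_C^s$, where $C$ runs over the minimal vertex covers of $G$ and $P_C=(x_i:i\in C)$. For a nonzero finitely generated graded $S$-module $M$, $\beta_{i,j}(M)=\dim_{\mathbb K}\operatorname{Tor}_i^S(M,\mathbb K)_j$ and $\operatorname{reg}M=\max\{j-i:\beta_{i,j}(M)\neq 0\}$. For a monomial ideal $L$, $L_{\langle d\rangle}$ is the ideal generated by the degree $d$ component of $L$; $L$ is componentwise linear if, for every $d$, $L_{\langle d\rangle}$ is zero or has a $d$-linear resolution, meaning $\beta_{i,j}(L_{\langle d\rangle})=0$ whenever $j\neq i+d$. *)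

theory Defs
  imports
    "HOL-Algebra.Ideal_Product"
    "HOL-Library.Poly_Mapping"
    "HOL-Library.Function_Algebras"
    "HOL-Library.Extended_Real"
begin

section \<open>Graphs on \<open>{1..n}\<close>\<close>

definition simple_graph :: "nat \<Rightarrow> nat set set \<Rightarrow> bool" where
  "simple_graph n E \<longleftrightarrow> (\<forall>e\<in>E. e \<subseteq> {1..n} \<and> card e = 2)"

definition complement_graph :: "nat \<Rightarrow> nat set set \<Rightarrow> nat set set" where
  "complement_graph n E = {e. e \<subseteq> {1..n} \<and> card e = 2 \<and> e \<notin> E}"

text \<open>The list \<open>c\<close> enumerates the vertices of the cycle in cyclic order; there are no further
  edges among them.\<close>

definition induced_cycle :: "nat \<Rightarrow> nat set set \<Rightarrow> nat list \<Rightarrow> bool" where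
  "induced_cycle n E c \<longleftrightarrow>
     3 \<le> length c \<and> distinct c \<and> set c \<subseteq> {1..n} \<and>
     (\<forall>i j. i < j \<and> j < length c \<longrightarrow>
        ({c ! i, c ! j} \<in> E \<longleftrightarrow> j = Suc i \<or> (i = 0 \<and> Suc j = length c)))"

definition chordal :: "nat \<Rightarrow> nat set set \<Rightarrow> bool" where
  "chordal n E \<longleftrightarrow> \<not> (\<exists>c. induced_cycle n E c \<and> 4 \<le> length c)"

definition cochordal :: "nat \<Rightarrow> nat set set \<Rightarrow> bool" where
  "cochordal n E \<longleftrightarrow> chordal n (complement_graph n E)"

definition vertex_cover :: "nat \<Rightarrow> nat set set \<Rightarrow> nat set \<Rightarrow> bool" where
  "vertex_cover n E C \<longleftrightarrow> C \<subseteq> {1..n} \<and> (\<forall>e\<in>E. e \<inter> C \<noteq> {})"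

definition minimal_vertex_cover :: "nat \<Rightarrow> nat set set \<Rightarrow> nat set \<Rightarrow> bool" where
  "minimal_vertex_cover n E C \<longleftrightarrow>
     vertex_cover n E C \<and> (\<forall>D. D \<subset> C \<longrightarrow> \<not> vertex_cover n E D)"


section \<open>The polynomial ring in \<open>x\<^sub>1, \<dots>, x\<^sub>n\<close>\<close>

text \<open>A monomial is its exponent vector \<open>nat \<Rightarrow>\<^sub>0 nat\<close>. The type \<open>mpoly\<close> has variables indexed by
  all of \<open>nat\<close>; \<open>poly_ring n\<close> is the subring of polynomials in the variables \<open>1, \<dots>, n\<close>.\<close>

type_synonym 'a mpoly = "(nat \<Rightarrow>\<^sub>0 nat) \<Rightarrow>\<^sub>0 'a"

definition poly_ring :: "nat \<Rightarrow> ('a::field) mpoly ring" where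
  "poly_ring n =
     \<lparr>carrier = {p. \<forall>m\<in>Poly_Mapping.keys p. Poly_Mapping.keys m \<subseteq> {1..n}},
      mult = (*), one = 1, zero = 0, add = (+)\<rparr>"

definition var :: "nat \<Rightarrow> ('a::field) mpoly" where
  "var i = Poly_Mapping.single (Poly_Mapping.single i 1) 1"

definition mon_deg :: "(nat \<Rightarrow>\<^sub>0 nat) \<Rightarrow> nat" where
  "mon_deg m = (\<Sum>i\<in>Poly_Mapping.keys m. Poly_Mapping.lookup m i)"

definition homogeneous :: "nat \<Rightarrow> ('a::field) mpoly \<Rightarrow> bool" where
  "homogeneous d p \<longleftrightarrow> (\<forall>m\<in>Poly_Mapping.keys p. mon_deg m = d)"

lemma cring_poly_ring: "cring (poly_ring n :: ('a::field) mpoly ring)"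
proof -
  let ?R = "poly_ring n :: 'a mpoly ring"
  have car: "p \<in> carrier ?R \<longleftrightarrow> (\<forall>m\<in>Poly_Mapping.keys p. Poly_Mapping.keys m \<subseteq> {1..n})" for p
    by (simp add: poly_ring_def)
  have ops: "mult ?R = (*)" "one ?R = 1" "zero ?R = 0" "add ?R = (+)"
    by (simp_all add: poly_ring_def)
  have add: "p + q \<in> carrier ?R" if "p \<in> carrier ?R" "q \<in> carrier ?R" for p q
    using that Poly_Mapping.keys_add[of p q] unfolding car by blast
  have mult: "p * q \<in> carrier ?R" if p: "p \<in> carrier ?R" and q: "q \<in> carrier ?R" for p q
    unfolding car
  proof
    fix m assume "m \<in> Poly_Mapping.keys (p * q)"
    then obtain a b where ab: "a \<in> Poly_Mapping.keys p" "b \<in> Poly_Mapping.keys q" "m = a + b"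
      using keys_mult[of p q] by blast
    have "Poly_Mapping.keys a \<subseteq> {1..n}" "Poly_Mapping.keys b \<subseteq> {1..n}"
      using p q ab(1,2) unfolding car by blast+
    then show "Poly_Mapping.keys m \<subseteq> {1..n}"
      using Poly_Mapping.keys_add[of a b] unfolding ab(3) by blast
  qed
  have neg: "- p \<in> carrier ?R" if "p \<in> carrier ?R" for p
    using that unfolding car by simp
  have zero: "0 \<in> carrier ?R" and one: "1 \<in> carrier ?R"
    unfolding car by simp_all
  show ?thesis
  proof (rule cringI)
    show "abelian_group ?R"
    proof (rule abelian_groupI, unfold ops)
      fix p assume "p \<in> carrier ?R"
      then show "\<exists>q\<in>carrier ?R. q + p = 0"
        using neg by (intro bexI[of _ "- p"]) simp_all
    qed (simp_all add: add zero add.assoc add.commute)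
    show "Group.comm_monoid ?R"
      by (rule comm_monoidI, unfold ops) (simp_all add: mult one mult.assoc mult.commute)
  qed (simp add: ops distrib_right)
qed


section \<open>Symbolic powers of edge ideals\<close>

definition cover_prime :: "nat \<Rightarrow> nat set \<Rightarrow> ('a::field) mpoly set" where
  "cover_prime n C = Idl\<^bsub>poly_ring n\<^esub> (var ` C)"

text \<open>\<open>ideals_set R\<close> is the semiring of ideals of \<open>R\<close>, so the power below is the ordinary
  power of an ideal.\<close>

definition edge_symbolic_power :: "nat \<Rightarrow> nat set set \<Rightarrow> nat \<Rightarrow> ('a::field) mpoly set" where
  "edge_symbolic_power n E s =
     (\<Inter>C\<in>{C. minimal_vertex_cover n E C}. cover_prime n C [^]\<^bsub>ideals_set (poly_ring n)\<^esub> s)"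

definition degree_component_ideal :: "nat \<Rightarrow> nat \<Rightarrow> ('a::field) mpoly set \<Rightarrow> 'a mpoly set" where
  "degree_component_ideal n d L = Idl\<^bsub>poly_ring n\<^esub> {p\<in>L. homogeneous d p}"


section \<open>Graded free resolutions, Tor and Betti numbers\<close>

text \<open>Data of a graded free resolution \<open>\<dots> \<rightarrow> F\<^sub>1 \<rightarrow> F\<^sub>0 \<rightarrow> M \<rightarrow> 0\<close> of a homogeneous ideal \<open>M\<close>:
  \<open>F\<^sub>i\<close> has a basis \<open>e\<^sub>k\<close> (\<open>k < res_rank F i\<close>) with \<open>e\<^sub>k\<close> of degree \<open>res_twist F i k\<close>,
  that is, \<open>F\<^sub>i\<close> is the direct sum of the \<open>S(- res_twist F i k)\<close>; the augmentation sends \<open>e\<^sub>k\<close> to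
  \<open>res_aug F k\<close>, and \<open>res_mat F i\<close> is the matrix (row index first) of the differential
  \<open>F\<^sub>i\<^sub>+\<^sub>1 \<rightarrow> F\<^sub>i\<close>. Resolutions by finitely generated free modules generated in nonnegative degrees
  always exist, since \<open>S\<close> is Noetherian and \<open>M\<close> lives in nonnegative degrees.\<close>

record (overloaded) 'a resolution =
  res_rank :: "nat \<Rightarrow> nat"
  res_twist :: "nat \<Rightarrow> nat \<Rightarrow> nat"
  res_aug :: "nat \<Rightarrow> 'a mpoly"
  res_mat :: "nat \<Rightarrow> nat \<Rightarrow> nat \<Rightarrow> 'a mpoly"

definition res_module :: "nat \<Rightarrow> ('a::field) resolution \<Rightarrow> nat \<Rightarrow> (nat \<Rightarrow> 'a mpoly) set" where
  "res_module n F i =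
     {v. \<forall>k. v k \<in> carrier (poly_ring n) \<and> (res_rank F i \<le> k \<longrightarrow> v k = 0)}"

definition res_aug_map :: "('a::field) resolution \<Rightarrow> (nat \<Rightarrow> 'a mpoly) \<Rightarrow> 'a mpoly" where
  "res_aug_map F v = (\<Sum>k<res_rank F 0. v k * res_aug F k)"

definition res_diff :: "('a::field) resolution \<Rightarrow> nat \<Rightarrow> (nat \<Rightarrow> 'a mpoly) \<Rightarrow> nat \<Rightarrow> 'a mpoly" where
  "res_diff F i v l =
     (if l < res_rank F i then \<Sum>k<res_rank F (Suc i). res_mat F i l k * v k else 0)"

definition graded_free_resolution ::
  "nat \<Rightarrow> ('a::field) mpoly set \<Rightarrow> 'a resolution \<Rightarrow> bool" where
  "graded_free_resolution n M F \<longleftrightarrow>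
     (\<forall>k<res_rank F 0. res_aug F k \<in> M \<and> homogeneous (res_twist F 0 k) (res_aug F k)) \<and>
     (\<forall>i. \<forall>l<res_rank F i. \<forall>k<res_rank F (Suc i).
        res_mat F i l k \<in> carrier (poly_ring n) \<and>
        (\<forall>m\<in>Poly_Mapping.keys (res_mat F i l k).
           mon_deg m + res_twist F i l = res_twist F (Suc i) k)) \<and>
     res_aug_map F ` res_module n F 0 = M \<and>
     {v\<in>res_module n F 0. res_aug_map F v = 0} = res_diff F 0 ` res_module n F 1 \<and>
     (\<forall>i. {v\<in>res_module n F (Suc i). res_diff F i v = 0} =
          res_diff F (Suc i) ` res_module n F (Suc (Suc i)))"

text \<open>The complex \<open>F \<otimes>\<^sub>S K\<close>, where \<open>K = S / (x\<^sub>1, \<dots>, x\<^sub>n)\<close>: its \<open>i\<close>-th term has \<open>K\<close>-basis the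
  \<open>e\<^sub>k \<otimes> 1\<close>, and its differentials are the matrices of constant coefficients of
  \<open>res_mat F i\<close>. The degree \<open>j\<close> part is spanned by the \<open>e\<^sub>k \<otimes> 1\<close> with \<open>e\<^sub>k\<close> of degree \<open>j\<close>.\<close>

definition tensor_module :: "('a::field) resolution \<Rightarrow> nat \<Rightarrow> nat \<Rightarrow> (nat \<Rightarrow> 'a) set" where
  "tensor_module F i j =
     {v. \<forall>k. v k \<noteq> 0 \<longrightarrow> k < res_rank F i \<and> res_twist F i k = j}"

definition tensor_diff :: "('a::field) resolution \<Rightarrow> nat \<Rightarrow> (nat \<Rightarrow> 'a) \<Rightarrow> nat \<Rightarrow> 'a" where
  "tensor_diff F i v l =
     (if l < res_rank F i
      then \<Sum>k<res_rank F (Suc i). Poly_Mapping.lookup (res_mat F i l k) 0 * v k else 0)"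

definition tensor_cycles :: "('a::field) resolution \<Rightarrow> nat \<Rightarrow> nat \<Rightarrow> (nat \<Rightarrow> 'a) set" where
  "tensor_cycles F i j =
     {v\<in>tensor_module F i j. \<forall>h. i = Suc h \<longrightarrow> tensor_diff F h v = 0}"

definition tensor_boundaries :: "('a::field) resolution \<Rightarrow> nat \<Rightarrow> nat \<Rightarrow> (nat \<Rightarrow> 'a) set" where
  "tensor_boundaries F i j = tensor_diff F i ` tensor_module F (Suc i) j"

definition vec_dim :: "(nat \<Rightarrow> 'a::field) set \<Rightarrow> nat" where
  "vec_dim V = vector_space.dim (\<lambda>c v k. c * v k) V"

text \<open>The dimension of the degree \<open>j\<close> part of the homology \<open>H\<^sub>i(F \<otimes>\<^sub>S K)\<close>, i.e. of the
  quotient of the cycles by the subspace of boundaries; all spaces are finite-dimensional.\<close>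

definition tor_dim :: "('a::field) resolution \<Rightarrow> nat \<Rightarrow> nat \<Rightarrow> nat" where
  "tor_dim F i j = vec_dim (tensor_cycles F i j) - vec_dim (tensor_boundaries F i j)"

text \<open>\<open>dim Tor\<^sub>i(M, K)\<^sub>j\<close> for a homogeneous ideal \<open>M\<close>; it does not depend on the resolution
  chosen.\<close>

definition betti :: "nat \<Rightarrow> ('a::field) mpoly set \<Rightarrow> nat \<Rightarrow> nat \<Rightarrow> nat" where
  "betti n M i j = tor_dim (SOME F. graded_free_resolution n M F) i j"

text \<open>For \<open>M \<noteq> 0\<close> only finitely many Betti numbers are nonzero and at least one is, so the
  supremum is a maximum.\<close>

definition regularity :: "nat \<Rightarrow> ('a::field) mpoly set \<Rightarrow> ereal" where
  "regularity n M = Sup {ereal (real j - real i) | i j. betti n M i j \<noteq> 0}"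

definition has_linear_resolution :: "nat \<Rightarrow> nat \<Rightarrow> ('a::field) mpoly set \<Rightarrow> bool" where
  "has_linear_resolution n d M \<longleftrightarrow> (\<forall>i j. j \<noteq> i + d \<longrightarrow> betti n M i j = 0)"

definition componentwise_linear :: "nat \<Rightarrow> ('a::field) mpoly set \<Rightarrow> bool" where
  "componentwise_linear n L \<longleftrightarrow>
     (\<forall>d. degree_component_ideal n d L = {0} \<or>
          has_linear_resolution n d (degree_component_ideal n d L))"

end

(* Let H be two triangles glued along an edge {1,2}, with opposite vertices 3 and 4 and a further
   triangle attached to each of the other four edges, together with s - 4 isolated vertices. H is
   chordal, and G is its complement, on n = s + 4 vertices. Since vertex covers of G are complements
   of cliques of H, the squarefree monomials of degree s + 2 in the symbolic power correspond to pairs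
   of vertices that meet all triangles of H, and the only such pairs are {1,2} and {3,4}. The two
   resulting generators x_1...x_n/(x_1 x_2) and x_1...x_n/(x_3 x_4) are not linked by linear syzygies
   in multidegree x_1...x_n, which gives a first syzygy of degree s + 4.

   Betti numbers are defined from an arbitrarily chosen resolution, so one needs that a graded free
   resolution exists (Dickson's lemma and leading terms show that graded submodules of free modules
   are finitely generated), and that this syzygy survives in Tor for every resolution. *)

theory Submission
  imports Defs "HOL-Library.Product_Lexorder"
begin

section \<open>Polynomials and monomials\<close>

text \<open>The shape of H comes from a covering count. A triangle contained in the support of a
  squarefree monomial of degree s + 2 leaves degree s - 1 < s on the complementary cover, which
  excludes the monomial. Each vertex lies on at most two of the four outer triangles 135, 237, 248,
  146, which form a ring with common vertices 3, 2, 4, 1; a pair that meets all four must therefore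
  be {1,2} or {3,4}. An isolated vertex of H raises both s and the degree of the two generators by
  one.

  The obstacle in the algebra is that \<open>graded_free_resolution\<close> knows total degrees
  only: matrix entries and augmentations need not be multihomogeneous, so the multidegree x_1...x_n
  cannot be read off a basis element. A linear functional on syzygies, built from the coefficient of
  that monomial, takes its place; it sees only constant coefficients of multipliers and so descends
  to Tor. As \<open>tor_dim\<close> is a truncated difference of natural numbers, nonvanishing means
  a strict inequality of dimensions, obtained from a cycle outside the span of the
  boundaries.\<close>

lemma carrier_poly_ring:
  "p \<in> carrier (poly_ring n) \<longleftrightarrow> (\<forall>m\<in>Poly_Mapping.keys p. Poly_Mapping.keys m \<subseteq> {1..n})"
  by (simp add: poly_ring_def)

lemma poly_ring_ops:
  "mult (poly_ring n) = (*)" "one (poly_ring n) = 1" "zero (poly_ring n) = 0"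
  "add (poly_ring n) = (+)"
  by (simp_all add: poly_ring_def)

lemma carrier_zero: "0 \<in> carrier (poly_ring n)"
  by (simp add: carrier_poly_ring)

lemma carrier_add:
  "p \<in> carrier (poly_ring n) \<Longrightarrow> q \<in> carrier (poly_ring n) \<Longrightarrow> p + q \<in> carrier (poly_ring n)"
  using keys_add[of p q] by (auto simp: carrier_poly_ring)

lemma carrier_mult:
  fixes p :: "('a::field) mpoly"
  assumes "p \<in> carrier (poly_ring n)" "q \<in> carrier (poly_ring n)"
  shows "p * q \<in> carrier (poly_ring n)"
proof -
  interpret cring "poly_ring n :: 'a mpoly ring" by (rule cring_poly_ring)
  show ?thesis using m_closed[OF assms] by (simp add: poly_ring_ops)
qed

lemma carrier_single: "Poly_Mapping.keys m \<subseteq> {1..n} \<Longrightarrow> Poly_Mapping.single m c \<in> carrier (poly_ring n)"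
  by (simp add: carrier_poly_ring)

lemma keys_add_nat:
  fixes a b :: "'b \<Rightarrow>\<^sub>0 nat"
  shows "Poly_Mapping.keys (a + b) = Poly_Mapping.keys a \<union> Poly_Mapping.keys b"
  by (auto simp: in_keys_iff lookup_add)

lemma mon_deg_eq_sum:
  assumes "finite I" "Poly_Mapping.keys m \<subseteq> I"
  shows "mon_deg m = (\<Sum>i\<in>I. Poly_Mapping.lookup m i)"
  unfolding mon_deg_def using assms by (intro sum.mono_neutral_left) (auto simp: in_keys_iff)

lemma mon_deg_add: "mon_deg (a + b) = mon_deg a + mon_deg b"
proof -
  let ?I = "Poly_Mapping.keys a \<union> Poly_Mapping.keys b"
  have "mon_deg x = (\<Sum>i\<in>?I. Poly_Mapping.lookup x i)" if "Poly_Mapping.keys x \<subseteq> ?I" for x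
    using that by (intro mon_deg_eq_sum) auto
  then show ?thesis
    by (simp add: keys_add_nat lookup_add sum.distrib)
qed

lemma mon_deg_zero: "mon_deg 0 = 0"
  by (simp add: mon_deg_def)

definition mon_dvd :: "(nat \<Rightarrow>\<^sub>0 nat) \<Rightarrow> (nat \<Rightarrow>\<^sub>0 nat) \<Rightarrow> bool" where
  "mon_dvd a b \<longleftrightarrow> (\<forall>i. Poly_Mapping.lookup a i \<le> Poly_Mapping.lookup b i)"

lemma mon_dvd_iff: "mon_dvd a b \<longleftrightarrow> (\<exists>c. b = a + c)"
proof
  assume "mon_dvd a b"
  then have "b = a + (b - a)"
    by (intro poly_mapping_eqI) (simp add: mon_dvd_def lookup_add lookup_minus)
  then show "\<exists>c. b = a + c" ..
qed (auto simp: mon_dvd_def lookup_add)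

lemma mon_dvd_trans: "mon_dvd a b \<Longrightarrow> mon_dvd b c \<Longrightarrow> mon_dvd a c"
  unfolding mon_dvd_def by (meson order_trans)

lemma mon_dvd_keys: "mon_dvd a b \<Longrightarrow> Poly_Mapping.keys a \<subseteq> Poly_Mapping.keys b"
  by (auto simp: mon_dvd_iff keys_add_nat)

lemma mon_dvd_antisym: "mon_dvd a b \<Longrightarrow> mon_dvd b a \<Longrightarrow> a = b"
  by (intro poly_mapping_eqI) (simp add: mon_dvd_def antisym)

lemma finite_bounded_monomials:
  assumes "finite I"
  shows "finite {m. Poly_Mapping.keys m \<subseteq> I \<and> mon_deg m \<le> D}"
proof -
  let ?S = "{m. Poly_Mapping.keys m \<subseteq> I \<and> mon_deg m \<le> D}"
  have le: "Poly_Mapping.lookup m i \<le> D" if "m \<in> ?S" "i \<in> I" for m i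
    using that assms mon_deg_eq_sum[of I m] member_le_sum[of i I "Poly_Mapping.lookup m"]
    by simp
  have "Poly_Mapping.lookup ` ?S \<subseteq> {f. \<forall>i. (i \<in> I \<longrightarrow> f i \<in> {..D}) \<and> (i \<notin> I \<longrightarrow> f i = 0)}"
    using le by (auto simp: in_keys_iff)
  moreover have "finite {f. \<forall>i. (i \<in> I \<longrightarrow> f i \<in> {..D}) \<and> (i \<notin> I \<longrightarrow> f i = (0::nat))}"
    using assms by (intro finite_set_of_finite_funs) auto
  ultimately have "finite (Poly_Mapping.lookup ` ?S)"
    by (rule finite_subset)
  moreover have "inj_on Poly_Mapping.lookup ?S"
    by (auto simp: inj_on_def intro: poly_mapping_eqI)
  ultimately show ?thesis
    using finite_imageD by blast
qed

lemma poly_eq_sum_single: "p = (\<Sum>m\<in>Poly_Mapping.keys p. Poly_Mapping.single m (Poly_Mapping.lookup p m))"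
proof (rule poly_mapping_eqI)
  fix k
  have "Poly_Mapping.lookup (\<Sum>m\<in>Poly_Mapping.keys p. Poly_Mapping.single m (Poly_Mapping.lookup p m)) k
      = (\<Sum>m\<in>Poly_Mapping.keys p. if m = k then Poly_Mapping.lookup p k else 0)"
    unfolding lookup_sum by (intro sum.cong) (auto simp: lookup_single when_def)
  then show "Poly_Mapping.lookup p k =
      Poly_Mapping.lookup (\<Sum>m\<in>Poly_Mapping.keys p. Poly_Mapping.single m (Poly_Mapping.lookup p m)) k"
    by (simp add: in_keys_iff)
qed

text \<open>The coefficient of a product at \<open>m\<close> only involves pairs with
  \<open>a + b = m\<close>. Replacing factors under this local hypothesis avoids all manipulation of
  convolution sums later on.\<close>

lemma lookup_mult_cong:
  fixes p q :: "'b::monoid_add \<Rightarrow>\<^sub>0 'a::semiring_0"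
  assumes "\<And>a b. m = a + b \<Longrightarrow> Poly_Mapping.lookup p a * Poly_Mapping.lookup q b =
             Poly_Mapping.lookup p' a * Poly_Mapping.lookup q' b"
  shows "Poly_Mapping.lookup (p * q) m = Poly_Mapping.lookup (p' * q') m"
proof -
  have "(\<lambda>(a, b). Poly_Mapping.lookup p a * Poly_Mapping.lookup q b when m = a + b) =
    (\<lambda>(a, b). Poly_Mapping.lookup p' a * Poly_Mapping.lookup q' b when m = a + b)"
    using assms by (auto simp: fun_eq_iff when_def)
  then show ?thesis
    by (simp add: times_poly_mapping.rep_eq prod_fun_unfold_prod)
qed

lemma lookup_single_mult:
  fixes p :: "(nat \<Rightarrow>\<^sub>0 nat) \<Rightarrow>\<^sub>0 'a::semiring_0"
  shows "Poly_Mapping.lookup (Poly_Mapping.single a c * p) (a + m) = c * Poly_Mapping.lookup p m"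
proof -
  have "Poly_Mapping.lookup (Poly_Mapping.single a c * p) (a + m)
      = (\<Sum>l. (c when a = l) * (\<Sum>q. Poly_Mapping.lookup p q when a + m = l + q))"
    by (simp add: lookup_mult lookup_single)
  also have "\<dots> = (\<Sum>l. (c * (\<Sum>q. Poly_Mapping.lookup p q when a + m = l + q) when a = l))"
    by (simp add: when_mult)
  also have "\<dots> = c * (\<Sum>q. Poly_Mapping.lookup p q when a + m = a + q)"
    by simp
  finally show ?thesis by simp
qed

lemma keys_single_mult:
  fixes p :: "(nat \<Rightarrow>\<^sub>0 nat) \<Rightarrow>\<^sub>0 'a::semiring_0"
  shows "Poly_Mapping.keys (Poly_Mapping.single a c * p) \<subseteq> (+) a ` Poly_Mapping.keys p"
  using keys_mult[of "Poly_Mapping.single a c" p] by (auto split: if_splits)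

text \<open>Zero is a sum of exponent vectors only as 0 + 0. This is multiplicativity of the
  reduction from the polynomial ring to the field, which turns identities between matrices of a
  resolution into identities after tensoring.\<close>

lemma lookup_mult_zero:
  fixes p q :: "('a::field) mpoly"
  shows "Poly_Mapping.lookup (p * q) 0 = Poly_Mapping.lookup p 0 * Poly_Mapping.lookup q 0"
proof -
  have *: "a = 0 \<and> b = 0" if "0 = a + b" for a b :: "nat \<Rightarrow>\<^sub>0 nat"
    using that by (auto simp: poly_mapping_eq_iff fun_eq_iff lookup_add)
  have "Poly_Mapping.lookup (p * q) 0 =
      Poly_Mapping.lookup (Poly_Mapping.single 0 (Poly_Mapping.lookup p 0) * q) 0"
  proof (rule lookup_mult_cong)
    fix a b :: "nat \<Rightarrow>\<^sub>0 nat"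
    assume "0 = a + b"
    from *[OF this] show "Poly_Mapping.lookup p a * Poly_Mapping.lookup q b =
        Poly_Mapping.lookup (Poly_Mapping.single 0 (Poly_Mapping.lookup p 0)) a * Poly_Mapping.lookup q b"
      by simp
  qed
  then show ?thesis
    using lookup_single_mult[of 0 _ q 0] by simp
qed

text \<open>The linear projection onto the monomials satisfying \<open>P\<close>. It serves twice:
  for homogeneous components, and for cutting a polynomial down to a set of monomials that is not
  determined by degree.\<close>

definition restr :: "('b \<Rightarrow> bool) \<Rightarrow> ('b \<Rightarrow>\<^sub>0 'a::zero) \<Rightarrow> 'b \<Rightarrow>\<^sub>0 'a" where
  "restr P p = Poly_Mapping.mapp (\<lambda>m c. c when P m) p"

lemma lookup_restr: "Poly_Mapping.lookup (restr P p) m = (Poly_Mapping.lookup p m when P m)"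
  by (simp add: restr_def lookup_mapp in_keys_iff when_def)

lemma keys_restr: "Poly_Mapping.keys (restr P p) = {m \<in> Poly_Mapping.keys p. P m}"
  by (auto simp: in_keys_iff lookup_restr)

lemma restr_sum: "restr P (sum f I) = (\<Sum>i\<in>I. restr P (f i))"
  by (intro poly_mapping_eqI) (simp add: lookup_restr lookup_sum when_def)

lemma restr_zero: "restr P 0 = 0"
  by (intro poly_mapping_eqI) (simp add: lookup_restr)

text \<open>The two predicates differ by the shift that \<open>q\<close> causes. For
  \<open>q\<close> homogeneous of degree e, with \<open>P\<close> and \<open>Q\<close> fixing the
  degrees D - e and D, this says that multiplication by \<open>q\<close> respects homogeneous
  components.\<close>

lemma restr_mult:
  fixes p q :: "'b::monoid_add \<Rightarrow>\<^sub>0 'a::semiring_0"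
  assumes "\<And>a b. b \<in> Poly_Mapping.keys q \<Longrightarrow> Q (a + b) \<longleftrightarrow> P a"
  shows "restr Q (p * q) = restr P p * q"
proof (rule poly_mapping_eqI)
  fix m
  have "Poly_Mapping.lookup (restr P p * q) m = Poly_Mapping.lookup (if Q m then p * q else 0 * q) m"
  proof (cases "Q m")
    case True
    have "Poly_Mapping.lookup (restr P p) a * Poly_Mapping.lookup q b =
        Poly_Mapping.lookup p a * Poly_Mapping.lookup q b" if "m = a + b" for a b
      using assms[of b a] that True
      by (cases "Poly_Mapping.lookup q b = 0") (simp_all add: lookup_restr in_keys_iff)
    then show ?thesis using True by (simp only: if_True) (rule lookup_mult_cong)
  next
    case False
    have "Poly_Mapping.lookup (restr P p) a * Poly_Mapping.lookup q b =
        Poly_Mapping.lookup 0 a * Poly_Mapping.lookup q b" if "m = a + b" for a b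
      using assms[of b a] that False
      by (cases "Poly_Mapping.lookup q b = 0") (simp_all add: lookup_restr in_keys_iff)
    then show ?thesis using False by (simp only: if_False) (rule lookup_mult_cong)
  qed
  then show "Poly_Mapping.lookup (restr Q (p * q)) m = Poly_Mapping.lookup (restr P p * q) m"
    by (simp add: lookup_restr when_def)
qed

lemma carrier_restr: "p \<in> carrier (poly_ring n) \<Longrightarrow> restr P p \<in> carrier (poly_ring n)"
  by (auto simp: carrier_poly_ring keys_restr)

section \<open>Dickson's lemma\<close>

text \<open>Coordinates are treated one after the other: a monotone subsequence in the new
  coordinate either increases or, being a decreasing sequence of naturals, is eventually constant.
  Passing to a subsequence preserves what was achieved for earlier coordinates.\<close>

lemma monotone_subsequence:
  fixes f :: "nat \<Rightarrow> 'i \<Rightarrow> nat"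
  assumes "finite I"
  shows "\<exists>g::nat \<Rightarrow> nat. strict_mono g \<and> (\<forall>x\<in>I. \<forall>i j. i \<le> j \<longrightarrow> f (g i) x \<le> f (g j) x)"
  using assms
proof (induction I)
  case empty
  show ?case by (auto intro: exI[of _ id] simp: strict_mono_def)
next
  case (insert y I)
  then obtain g :: "nat \<Rightarrow> nat" where g: "strict_mono g"
      "\<And>x i j. x \<in> I \<Longrightarrow> i \<le> j \<Longrightarrow> f (g i) x \<le> f (g j) x" by blast
  let ?s = "\<lambda>i. f (g i) y"
  have "\<exists>h::nat \<Rightarrow> nat. strict_mono h \<and> (\<forall>i j. i \<le> j \<longrightarrow> ?s (h i) \<le> ?s (h j))"
  proof -
    obtain h where h: "strict_mono h" "monoseq (\<lambda>n. ?s (h n))"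
      using seq_monosub[of ?s] by blast
    show ?thesis
    proof (cases "\<forall>i j. i \<le> j \<longrightarrow> ?s (h i) \<le> ?s (h j)")
      case False
      then have dec: "\<And>i j. i \<le> j \<Longrightarrow> ?s (h j) \<le> ?s (h i)"
        using h(2) unfolding monoseq_def by blast
      \<comment> \<open>The decreasing sequence attains its minimum at \<open>k\<close> and is
        constant from there on.\<close>
      define k where "k = (ARG_MIN (\<lambda>i. ?s (h i)) i. True)"
      have k: "?s (h k) \<le> ?s (h i)" for i
        unfolding k_def by (rule arg_min_nat_le) simp
      have "?s (h (k + i)) = ?s (h k)" for i
        using k[of "k + i"] dec[of k "k + i"] by simp
      then show ?thesis
        using h(1) by (intro exI[of _ "\<lambda>i. h (k + i)"]) (auto simp: strict_mono_def)
    qed (use h in blast)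
  qed
  then obtain h :: "nat \<Rightarrow> nat" where h: "strict_mono h" "\<And>i j. i \<le> j \<Longrightarrow> ?s (h i) \<le> ?s (h j)" by blast
  have "strict_mono (g \<circ> h)"
    using g(1) h(1) by (simp add: strict_mono_def)
  moreover have "f ((g \<circ> h) i) x \<le> f ((g \<circ> h) j) x" if "x \<in> insert y I" "i \<le> j" for x i j
    using that h g(2) by (auto simp: strict_mono_less_eq)
  ultimately show ?case by blast
qed

text \<open>If no finite \<open>B\<close> worked, every finite subset of \<open>L\<close> would miss
  some element of \<open>L\<close>, and collecting such elements greedily would give a sequence in
  which no term lies below a later one. A monotone subsequence contradicts this. Arbitrary functions
  are allowed in place of exponent vectors so that further coordinates can be added.\<close>

lemma dickson:
  fixes L :: "('i \<Rightarrow> nat) set"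
  assumes "finite I"
  shows "\<exists>B\<subseteq>L. finite B \<and> (\<forall>f\<in>L. \<exists>b\<in>B. \<forall>x\<in>I. b x \<le> f x)"
proof (rule ccontr)
  assume *: "\<not> ?thesis"
  have "\<exists>f\<in>L. \<forall>b\<in>B. \<exists>x\<in>I. f x < b x" if "finite B" "B \<subseteq> L" for B
    using * that by (meson leI)
  then obtain c where c: "\<And>B. finite B \<Longrightarrow> B \<subseteq> L \<Longrightarrow> c B \<in> L \<and> (\<forall>b\<in>B. \<exists>x\<in>I. c B x < b x)"
    by metis
  define B where "B = rec_nat {} (\<lambda>_ B. insert (c B) B)"
  have B0: "B 0 = {}" and BS: "B (Suc i) = insert (c (B i)) (B i)" for i
    by (simp_all add: B_def)
  have B: "finite (B i) \<and> B i \<subseteq> L" for i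
    by (induction i) (auto simp: B0 BS c)
  have mem: "c (B i) \<in> B j" if "i < j" for i j
    using that by (induction j) (auto simp: BS less_Suc_eq)
  obtain g :: "nat \<Rightarrow> nat" where g: "strict_mono g" "\<And>x i j. x \<in> I \<Longrightarrow> i \<le> j \<Longrightarrow> c (B (g i)) x \<le> c (B (g j)) x"
    using monotone_subsequence[OF assms, of "\<lambda>i. c (B i)"] by blast
  have "g 0 < g 1" using g(1) by (simp add: strict_mono_def)
  then obtain x where "x \<in> I" "c (B (g 1)) x < c (B (g 0)) x"
    using c[of "B (g 1)"] B[of "g 1"] mem[of "g 0" "g 1"] by blast
  then show False using g(2)[of x 0 1] by simp
qed

lemma dickson_positions:
  fixes L :: "(nat \<times> (nat \<Rightarrow>\<^sub>0 nat)) set"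
  assumes L: "L \<subseteq> {..<r} \<times> {m. Poly_Mapping.keys m \<subseteq> {1..n}}"
  shows "\<exists>B\<subseteq>L. finite B \<and> (\<forall>k m. (k, m) \<in> L \<longrightarrow> (\<exists>m'. (k, m') \<in> B \<and> mon_dvd m' m))"
proof -
  \<comment> \<open>Comparability in the two extra coordinates \<open>k\<close> and \<open>r - k\<close> forces equal positions.\<close>
  define cv where "cv = (\<lambda>(k, m) i. if i = 0 then k else if i = Suc n then r - k else Poly_Mapping.lookup m i)"
  obtain C where C: "C \<subseteq> cv ` L" "finite C" "\<And>f. f \<in> cv ` L \<Longrightarrow> \<exists>b\<in>C. \<forall>x\<in>{0..Suc n}. b x \<le> f x"
    using dickson[of "{0..Suc n}" "cv ` L"] by blast
  obtain B where B: "B \<subseteq> L" "finite B" "C = cv ` B"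
    using C(1,2) finite_subset_image by metis
  have "\<exists>m'. (k, m') \<in> B \<and> mon_dvd m' m" if km: "(k, m) \<in> L" for k m
  proof -
    obtain k' m' where b: "(k', m') \<in> B" "\<And>x. x \<le> Suc n \<Longrightarrow> cv (k', m') x \<le> cv (k, m) x"
      using C(3)[of "cv (k, m)"] km B(3) by fastforce
    have "k < r" "k' < r" "Poly_Mapping.keys m' \<subseteq> {1..n}" using L km b(1) B(1) by auto
    moreover have "k' \<le> k" "r - k' \<le> r - k"
      using b(2)[of 0] b(2)[of "Suc n"] by (simp_all add: cv_def)
    ultimately have "k' = k" by simp
    moreover have "Poly_Mapping.lookup m' i \<le> Poly_Mapping.lookup m i" for i
    proof (cases "i \<in> {1..n}")
      case True
      then show ?thesis using b(2)[of i] by (simp add: cv_def)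
    next
      case False
      then have "Poly_Mapping.lookup m' i = 0"
        using \<open>Poly_Mapping.keys m' \<subseteq> {1..n}\<close> by (auto simp: in_keys_iff)
      then show ?thesis by simp
    qed
    ultimately show ?thesis using b(1) by (auto simp: mon_dvd_def)
  qed
  then show ?thesis using B by blast
qed

section \<open>Graded submodules of free modules are finitely generated\<close>

definition free_mod :: "nat \<Rightarrow> nat \<Rightarrow> (nat \<Rightarrow> ('a::field) mpoly) set" where
  "free_mod n r = {v. \<forall>k. v k \<in> carrier (poly_ring n) \<and> (r \<le> k \<longrightarrow> v k = 0)}"

definition hom_vec :: "(nat \<Rightarrow> nat) \<Rightarrow> nat \<Rightarrow> (nat \<Rightarrow> ('a::field) mpoly) \<Rightarrow> bool" where
  "hom_vec t D v \<longleftrightarrow> (\<forall>k. \<forall>m\<in>Poly_Mapping.keys (v k). mon_deg m + t k = D)"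

definition hom_comp :: "(nat \<Rightarrow> nat) \<Rightarrow> nat \<Rightarrow> (nat \<Rightarrow> ('a::field) mpoly) \<Rightarrow> nat \<Rightarrow> 'a mpoly" where
  "hom_comp t D v k = restr (\<lambda>m. mon_deg m + t k = D) (v k)"

text \<open>\<open>A k\<close> is the image of the k-th basis vector, so indices are transposed with
  respect to \<open>res_mat\<close>. This form lets a list of generators be used directly as a
  differential.\<close>

definition lin_comb :: "nat \<Rightarrow> (nat \<Rightarrow> nat \<Rightarrow> ('a::field) mpoly) \<Rightarrow> (nat \<Rightarrow> 'a mpoly) \<Rightarrow> nat \<Rightarrow> 'a mpoly" where
  "lin_comb q A v = (\<lambda>l. \<Sum>k<q. v k * A k l)"

definition graded_submodule :: "nat \<Rightarrow> nat \<Rightarrow> (nat \<Rightarrow> nat) \<Rightarrow> (nat \<Rightarrow> ('a::field) mpoly) set \<Rightarrow> bool" where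
  "graded_submodule n r t N \<longleftrightarrow> N \<subseteq> free_mod n r \<and> 0 \<in> N \<and> (\<forall>v\<in>N. \<forall>w\<in>N. v + w \<in> N) \<and>
     (\<forall>a\<in>carrier (poly_ring n). \<forall>v\<in>N. (\<lambda>k. a * v k) \<in> N) \<and>
     (\<forall>v\<in>N. \<forall>D. hom_comp t D v \<in> N)"

text \<open>The support of a vector as a set of module monomials. Under the lexicographic order on
  pairs its maximum is the leading term for a position-over-term order.\<close>

definition positions :: "(nat \<Rightarrow> ('a::field) mpoly) \<Rightarrow> (nat \<times> (nat \<Rightarrow>\<^sub>0 nat)) set" where
  "positions v = {(k, m). m \<in> Poly_Mapping.keys (v k)}"

lemma finite_positions:
  assumes "v \<in> free_mod n r"
  shows "finite (positions v)"
proof -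
  have "positions v \<subseteq> (SIGMA k:{..<r}. Poly_Mapping.keys (v k))"
  proof
    fix x assume x: "x \<in> positions v"
    obtain k m where km: "x = (k, m)" by force
    with x have "v k \<noteq> 0" by (auto simp: positions_def)
    then have "k < r" using assms by (auto simp: free_mod_def not_le[symmetric])
    then show "x \<in> (SIGMA k:{..<r}. Poly_Mapping.keys (v k))" using x km by (auto simp: positions_def)
  qed
  then show ?thesis by (rule finite_subset) auto
qed

lemma positions_eq_empty: "positions v = {} \<longleftrightarrow> v = 0"
proof
  assume "positions v = {}"
  then have "Poly_Mapping.keys (v k) = {}" for k by (auto simp: positions_def)
  then show "v = 0" by (auto simp: fun_eq_iff)
qed (simp add: positions_def)

lemma lin_comb_add: "lin_comb q A (v + w) = lin_comb q A v + lin_comb q A w"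
  by (simp add: lin_comb_def fun_eq_iff distrib_right sum.distrib)

lemma lin_comb_zero: "lin_comb q A 0 = 0"
  by (simp add: lin_comb_def fun_eq_iff)

lemma sum_fun_apply: "(\<Sum>k\<in>K. f k) l = (\<Sum>k\<in>K. f k l)"
  by (induction K rule: infinite_finite_induct) auto

lemma free_mod_zero: "0 \<in> free_mod n r"
  by (simp add: free_mod_def carrier_zero)

lemma free_mod_add: "v \<in> free_mod n r \<Longrightarrow> w \<in> free_mod n r \<Longrightarrow> v + w \<in> free_mod n r"
  by (simp add: free_mod_def carrier_add)

lemma free_mod_single:
  "k < r \<Longrightarrow> p \<in> carrier (poly_ring n) \<Longrightarrow> (\<lambda>j. if j = k then p else 0) \<in> free_mod n r"
  by (auto simp: free_mod_def carrier_zero)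

lemma lin_comb_single: "k < q \<Longrightarrow> lin_comb q A (\<lambda>j. if j = k then p else 0) = (\<lambda>l. p * A k l)"
  by (simp add: lin_comb_def fun_eq_iff if_distrib[of "\<lambda>x. x * _"] cong: if_cong)

lemma graded_submodule_lin_comb:
  assumes N: "graded_submodule n r t N" and A: "\<And>k. k < q \<Longrightarrow> A k \<in> N" and v: "v \<in> free_mod n q'"
  shows "lin_comb q A v \<in> N"
  using A
proof (induction q)
  case 0
  then show ?case using N by (simp add: lin_comb_def graded_submodule_def zero_fun_def)
next
  case (Suc q)
  have "lin_comb (Suc q) A v = lin_comb q A v + (\<lambda>l. v q * A q l)"
    by (simp add: lin_comb_def fun_eq_iff)
  moreover have "(\<lambda>l. v q * A q l) \<in> N"
    using N Suc.prems v by (auto simp: graded_submodule_def free_mod_def)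
  ultimately show ?case
    using Suc N unfolding graded_submodule_def by (metis less_SucI)
qed

text \<open>A Groebner basis argument. Finitely many homogeneous elements have leading terms
  dividing all leading terms of homogeneous elements of \<open>N\<close>; dividing by them reduces
  each homogeneous element to zero. Division terminates because only finitely many module monomials
  have a given degree.\<close>

theorem graded_submodule_finitely_generated:
  fixes N :: "(nat \<Rightarrow> ('a::field) mpoly) set"
  assumes N: "graded_submodule n r t N"
  shows "\<exists>q t' A. (\<forall>k<q. A k \<in> N \<and> hom_vec t (t' k) (A k)) \<and> N = lin_comb q A ` free_mod n q"
proof -
  have free: "N \<subseteq> free_mod n r" and add: "\<And>v w. v \<in> N \<Longrightarrow> w \<in> N \<Longrightarrow> v + w \<in> N"
    and smult: "\<And>a v. a \<in> carrier (poly_ring n) \<Longrightarrow> v \<in> N \<Longrightarrow> (\<lambda>k. a * v k) \<in> N"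
    and comp: "\<And>v D. v \<in> N \<Longrightarrow> hom_comp t D v \<in> N"
    using N by (auto simp: graded_submodule_def)
  \<comment> \<open>Only leading terms of homogeneous elements are recorded, so that the generators
    chosen for them are homogeneous.\<close>
  define L where "L = {Max (positions v) | v. v \<in> N \<and> v \<noteq> 0 \<and> (\<exists>D. hom_vec t D v)}"
  have Max_in: "Max (positions v) \<in> positions v" if "v \<in> N" "v \<noteq> 0" for v
    using that free finite_positions positions_eq_empty by (metis Max_in subsetD)
  have pos: "k < r \<and> Poly_Mapping.keys m \<subseteq> {1..n}" if "v \<in> N" "(k, m) \<in> positions v" for v k m
  proof -
    have "v \<in> free_mod n r" using that free by blast
    moreover have "m \<in> Poly_Mapping.keys (v k)" using that by (simp add: positions_def)
    ultimately show ?thesis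
      by (auto simp: free_mod_def carrier_poly_ring not_le[symmetric])
  qed
  have "k < r \<and> Poly_Mapping.keys m \<subseteq> {1..n}" if km: "(k, m) \<in> L" for k m
  proof -
    obtain v where "v \<in> N" "v \<noteq> 0" "(k, m) = Max (positions v)"
      using km unfolding L_def by blast
    then show ?thesis using Max_in[of v] pos[of v k m] by simp
  qed
  then have "L \<subseteq> {..<r} \<times> {m. Poly_Mapping.keys m \<subseteq> {1..n}}"
    by auto
  from dickson_positions[OF this] obtain B where B0: "B \<subseteq> L \<and> finite B \<and> (\<forall>k m. (k, m) \<in> L \<longrightarrow> (\<exists>m'. (k, m') \<in> B \<and> mon_dvd m' m))"
    by (elim exE)
  then have B: "B \<subseteq> L" "finite B" "\<And>k m. (k, m) \<in> L \<Longrightarrow> \<exists>m'. (k, m') \<in> B \<and> mon_dvd m' m"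
    by auto
  obtain h where h: "bij_betw h {..<card B} B"
    using ex_bij_betw_nat_finite[OF B(2)] by (auto simp: atLeast0LessThan)
  have "\<forall>b\<in>B. \<exists>v D. v \<in> N \<and> v \<noteq> 0 \<and> hom_vec t D v \<and> Max (positions v) = b"
  proof
    fix b assume "b \<in> B"
    then have "b \<in> L" using B(1) by blast
    then show "\<exists>v D. v \<in> N \<and> v \<noteq> 0 \<and> hom_vec t D v \<and> Max (positions v) = b"
      unfolding L_def by blast
  qed
  then have "\<forall>b\<in>B. \<exists>x. fst x \<in> N \<and> fst x \<noteq> 0 \<and> hom_vec t (snd x) (fst x) \<and> Max (positions (fst x)) = b"
    by fastforce
  then obtain x where x: "\<forall>b\<in>B. fst (x b) \<in> N \<and> fst (x b) \<noteq> 0 \<and> hom_vec t (snd (x b)) (fst (x b)) \<and> Max (positions (fst (x b))) = b"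
    by (elim bchoice[THEN exE])
  define f d where "f = (\<lambda>b. fst (x b))" and "d = (\<lambda>b. snd (x b))"
  have f: "f b \<in> N \<and> f b \<noteq> 0 \<and> hom_vec t (d b) (f b) \<and> Max (positions (f b)) = b" if "b \<in> B" for b
    using x that by (simp add: f_def d_def)
  define q where "q = card B"
  define A where "A = (\<lambda>k. f (h k))"
  define Span where "Span = lin_comb q A ` free_mod n q"
  have hB: "h k \<in> B" if "k < q" for k
    using h that by (auto simp: q_def bij_betw_def)
  have Span_add: "v + w \<in> Span" if vw: "v \<in> Span" "w \<in> Span" for v w
  proof -
    obtain x y where "v = lin_comb q A x" "w = lin_comb q A y" "x \<in> free_mod n q" "y \<in> free_mod n q"
      using vw unfolding Span_def by blast
    then show ?thesis
      unfolding Span_def by (intro image_eqI[of _ _ "x + y"]) (simp_all add: lin_comb_add free_mod_add)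
  qed
  have Span_zero: "0 \<in> Span"
    unfolding Span_def using lin_comb_zero free_mod_zero by (metis image_eqI)
  have Span_gen: "(\<lambda>k. p * f b k) \<in> Span" if bp: "b \<in> B" "p \<in> carrier (poly_ring n)" for b p
  proof -
    have "b \<in> h ` {..<q}" using h bp(1) by (simp add: q_def bij_betw_def)
    then obtain k where k: "k < q" "h k = b" by blast
    show ?thesis
      unfolding Span_def using bp k
      by (intro image_eqI[of _ _ "\<lambda>j. if j = k then p else 0"]) (simp_all add: lin_comb_single free_mod_single A_def)
  qed
  have hom_Span: "v \<in> Span" if "v \<in> N" "hom_vec t D v" for v D
  proof -
    define P where "P = {(k, m). k < r \<and> Poly_Mapping.keys m \<subseteq> {1..n} \<and> mon_deg m + t k = D}"
    have "P \<subseteq> {..<r} \<times> {m. Poly_Mapping.keys m \<subseteq> {1..n} \<and> mon_deg m \<le> D}"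
      by (auto simp: P_def)
    then have finP: "finite P"
      using finite_bounded_monomials[of "{1..n}" D] by (meson finite_SigmaI finite_atLeastAtMost finite_lessThan finite_subset)
    have posP: "positions v \<subseteq> P" if "v \<in> N" "hom_vec t D v" for v
    proof
      fix x assume x: "x \<in> positions v"
      obtain k m where km: "x = (k, m)" by force
      have "mon_deg m + t k = D" using that(2) x km by (auto simp: hom_vec_def positions_def)
      then show "x \<in> P" using pos[OF that(1), of k m] x km by (simp add: P_def)
    qed
    show ?thesis using that
    \<comment> \<open>The measure counts the module monomials of degree \<open>D\<close> up to the
      leading one; cancelling the leading term removes at least that term from the count.\<close>
    proof (induction "card {p \<in> P. p \<le> Max (positions v)}" arbitrary: v rule: less_induct)
      case less
      show ?case
      proof (cases "v = 0")
        case True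
        then show ?thesis using Span_zero by simp
      next
        case False
        obtain k m where km: "Max (positions v) = (k, m)" by force
        then have "(k, m) \<in> L" using less.prems False unfolding L_def by force
        then obtain m' where m': "(k, m') \<in> B" "mon_dvd m' m" using B(3) by blast
        then obtain a where a: "m = m' + a" by (auto simp: mon_dvd_iff)
        let ?g = "f (k, m')"
        have g: "?g \<in> N" "?g \<noteq> 0" "hom_vec t (d (k, m')) ?g" "Max (positions ?g) = (k, m')"
          using f[OF m'(1)] by auto
        have km_pos: "(k, m) \<in> positions v" "(k, m') \<in> positions ?g"
          using Max_in less.prems False km g by metis+
        have deg: "mon_deg m' + t k = d (k, m')" "mon_deg m + t k = D"
          using g(3) less.prems(2) km_pos by (auto simp: hom_vec_def positions_def)
        have keys_a: "Poly_Mapping.keys a \<subseteq> {1..n}"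
          using pos[OF less.prems(1) km_pos(1)] a by (auto simp: keys_add_nat)
        define c where "c = Poly_Mapping.lookup (v k) m / Poly_Mapping.lookup (?g k) m'"
        have "Poly_Mapping.lookup (?g k) m' \<noteq> 0" using km_pos(2) by (simp add: positions_def in_keys_iff)
        then have c: "c * Poly_Mapping.lookup (?g k) m' = Poly_Mapping.lookup (v k) m" by (simp add: c_def)
        define u where "u = (\<lambda>j. Poly_Mapping.single a (- c) * ?g j)"
        define w where "w = v + u"
        have uN: "u \<in> N"
          unfolding u_def using g(1) keys_a by (intro smult carrier_single)
        have wN: "w \<in> N" using add less.prems(1) uN by (simp add: w_def)
        have pos_u: "\<exists>b'. (j, b') \<in> positions ?g \<and> b = a + b'" if "(j, b) \<in> positions u" for j b
          using that keys_single_mult[of a "- c" "?g j"] by (auto simp: positions_def u_def)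
        have pos_w: "positions w \<subseteq> positions v \<union> positions u"
          using keys_add by (force simp: positions_def w_def)
        have hom_u: "hom_vec t D u"
          unfolding hom_vec_def
        proof (intro allI ballI)
          fix j b assume "b \<in> Poly_Mapping.keys (u j)"
          then obtain b' where b': "(j, b') \<in> positions ?g" "b = a + b'"
            using pos_u by (auto simp: positions_def)
          then have "mon_deg b' + t j = d (k, m')" using g(3) by (auto simp: hom_vec_def positions_def)
          then show "mon_deg b + t j = D" using deg b'(2) a by (simp add: mon_deg_add)
        qed
        have hom_w: "hom_vec t D w"
          using pos_w hom_u less.prems(2) unfolding hom_vec_def positions_def by blast
        have fin: "finite (positions x)" if "x \<in> N" for x
          using that free finite_positions by blast
        have lt: "x < (k, m)" if "x \<in> positions w" for x
        proof -
          have "x \<noteq> (k, m)"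
          proof
            assume "x = (k, m)"
            then have "Poly_Mapping.lookup (w k) m \<noteq> 0" using that by (simp add: positions_def in_keys_iff)
            moreover have "Poly_Mapping.lookup (u k) m = - c * Poly_Mapping.lookup (?g k) m'"
              using lookup_single_mult[of a "- c" "?g k" m'] a by (simp add: u_def add.commute)
            ultimately show False using c by (simp add: w_def lookup_add)
          qed
          \<comment> \<open>Multiplication by the monomial \<open>a\<close> preserves the order, so
            the leading term of \<open>u\<close> is the shift of that of \<open>?g\<close>, which is
            exactly \<open>(k, m)\<close>.\<close>
          moreover have "x \<le> (k, m)"
          proof (cases "x \<in> positions v")
            case True
            then show ?thesis using km fin[OF less.prems(1)] by (metis Max_ge)
          next
            case False
            then have "x \<in> positions u" using pos_w that by blast
            then obtain j b where x: "x = (j, b)" "(j, b) \<in> positions u"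
              by (cases x) auto
            then obtain b' where b': "(j, b') \<in> positions ?g" "b = a + b'" using pos_u by blast
            then have "(j, b') \<le> (k, m')" using g(4) fin[OF g(1)] by (metis Max_ge)
            then show ?thesis using x b'(2) a by (auto simp: add.commute)
          qed
          ultimately show ?thesis by simp
        qed
        have "w \<in> Span"
        proof (cases "w = 0")
          case True
          then show ?thesis using Span_zero by simp
        next
          case w0: False
          have Mw: "Max (positions w) < (k, m)" using lt Max_in[OF wN w0] by blast
          have "(k, m) \<in> P" using posP less.prems km_pos by blast
          then have "{p \<in> P. p \<le> Max (positions w)} \<subset> {p \<in> P. p \<le> Max (positions v)}"
            unfolding km using Mw by (auto dest: less_le_trans simp del: less_prod_simp less_eq_prod_simp)
          then have "card {p \<in> P. p \<le> Max (positions w)} < card {p \<in> P. p \<le> Max (positions v)}"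
            using finP by (intro psubset_card_mono) auto
          then show ?thesis using less.hyps wN hom_w by blast
        qed
        moreover have "(\<lambda>j. Poly_Mapping.single a c * ?g j) \<in> Span"
          using m'(1) keys_a by (intro Span_gen carrier_single)
        moreover have "v = w + (\<lambda>j. Poly_Mapping.single a c * ?g j)"
          by (simp add: w_def u_def fun_eq_iff single_uminus)
        ultimately show ?thesis using Span_add by metis
      qed
    qed
  qed
  have "N = Span"
  proof
    show "N \<subseteq> Span"
    proof
      fix v assume v: "v \<in> N"
      define Ds where "Ds = (\<lambda>(k, m). mon_deg m + t k) ` positions v"
      have finD: "finite Ds" using v free finite_positions unfolding Ds_def by blast
      have Span_sum: "sum g I \<in> Span" if "\<And>i. i \<in> I \<Longrightarrow> g i \<in> Span" for g and I :: "nat set"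
        using that by (induction I rule: infinite_finite_induct) (auto simp: Span_zero Span_add)
      have "v = (\<Sum>D\<in>Ds. hom_comp t D v)"
      proof
        fix k
        have "(\<Sum>D\<in>Ds. hom_comp t D v) k = (\<Sum>D\<in>Ds. hom_comp t D v k)"
          by (rule sum_fun_apply)
        also have "\<dots> = v k"
        proof (rule poly_mapping_eqI)
          fix m
          show "Poly_Mapping.lookup (\<Sum>D\<in>Ds. hom_comp t D v k) m = Poly_Mapping.lookup (v k) m"
          proof (cases "m \<in> Poly_Mapping.keys (v k)")
            case True
            then have "mon_deg m + t k \<in> Ds" by (force simp: Ds_def positions_def)
            then show ?thesis using finD by (simp add: lookup_sum hom_comp_def lookup_restr when_def)
          next
            case False
            then show ?thesis by (simp add: lookup_sum hom_comp_def lookup_restr in_keys_iff)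
          qed
        qed
        finally show "v k = (\<Sum>D\<in>Ds. hom_comp t D v) k" ..
      qed
      moreover have "hom_comp t D v \<in> Span" for D
        using comp[OF v] by (rule hom_Span[where D = D]) (auto simp: hom_vec_def hom_comp_def keys_restr)
      ultimately show "v \<in> Span" using Span_sum by metis
    qed
    have "A k \<in> N" if "k < q" for k
      using f[OF hB[OF that]] by (simp add: A_def)
    then show "Span \<subseteq> N"
      using graded_submodule_lin_comb[OF N] by (auto simp: Span_def)
  qed
  moreover have "A k \<in> N \<and> hom_vec t (d (h k)) (A k)" if "k < q" for k
    using f[OF hB[OF that]] by (simp add: A_def)
  ultimately show ?thesis
    unfolding Span_def by (intro exI[of _ q] exI[of _ "\<lambda>k. d (h k)"] exI[of _ A]) blast
qed

section \<open>Existence of graded free resolutions\<close>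

definition lin_kernel :: "nat \<Rightarrow> nat \<Rightarrow> (nat \<Rightarrow> nat \<Rightarrow> ('a::field) mpoly) \<Rightarrow> (nat \<Rightarrow> 'a mpoly) set" where
  "lin_kernel n q A = {v \<in> free_mod n q. lin_comb q A v = 0}"

lemma hom_comp_free_mod: "v \<in> free_mod n r \<Longrightarrow> hom_comp t D v \<in> free_mod n r"
  by (simp add: free_mod_def hom_comp_def carrier_restr restr_zero)

text \<open>A map whose basis images are homogeneous of the prescribed degrees preserves degrees.
  Hence its kernel is again a graded submodule, which is what makes the construction of a resolution
  iterable.\<close>

lemma lin_comb_hom_comp:
  assumes A: "\<And>k. k < q \<Longrightarrow> hom_vec t (t' k) (A k)"
  shows "lin_comb q A (hom_comp t' D v) = hom_comp t D (lin_comb q A v)"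
proof
  fix l
  have "restr (\<lambda>m. mon_deg m + t' k = D) (v k) * A k l = restr (\<lambda>m. mon_deg m + t l = D) (v k * A k l)"
    if "k < q" for k
  proof (rule restr_mult[symmetric])
    fix a b assume "b \<in> Poly_Mapping.keys (A k l)"
    then have "mon_deg b + t l = t' k" using A[OF that] by (auto simp: hom_vec_def)
    then show "mon_deg (a + b) + t l = D \<longleftrightarrow> mon_deg a + t' k = D" by (auto simp: mon_deg_add)
  qed
  then show "lin_comb q A (hom_comp t' D v) l = hom_comp t D (lin_comb q A v) l"
    by (simp add: lin_comb_def hom_comp_def restr_sum)
qed

lemma graded_submodule_lin_kernel:
  fixes A :: "nat \<Rightarrow> nat \<Rightarrow> ('a::field) mpoly"
  assumes A: "\<And>k. k < q \<Longrightarrow> hom_vec t (t' k) (A k)"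
  shows "graded_submodule n q t' (lin_kernel n q A)"
  unfolding graded_submodule_def
proof (intro conjI ballI allI)
  show "lin_kernel n q A \<subseteq> free_mod n q" by (auto simp: lin_kernel_def)
  show "0 \<in> lin_kernel n q A" by (simp add: lin_kernel_def free_mod_zero lin_comb_zero)
next
  fix v w assume "v \<in> lin_kernel n q A" "w \<in> lin_kernel n q A"
  then show "v + w \<in> lin_kernel n q A" by (simp add: lin_kernel_def free_mod_add lin_comb_add)
next
  fix a :: "'a mpoly" and v assume a: "a \<in> carrier (poly_ring n)" and v: "v \<in> lin_kernel n q A"
  have "lin_comb q A (\<lambda>k. a * v k) = (\<lambda>l. a * lin_comb q A v l)"
    by (simp add: lin_comb_def sum_distrib_left mult.assoc)
  then show "(\<lambda>k. a * v k) \<in> lin_kernel n q A"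
    using a v by (auto simp: lin_kernel_def free_mod_def carrier_mult fun_eq_iff)
next
  fix v D assume "v \<in> lin_kernel n q A"
  then show "hom_comp t' D v \<in> lin_kernel n q A"
    by (simp add: lin_kernel_def hom_comp_free_mod lin_comb_hom_comp[OF A])
      (simp add: hom_comp_def fun_eq_iff restr_zero)
qed

text \<open>Generate \<open>M\<close> by finitely many homogeneous elements, then repeatedly
  generate the kernel of the last map. The hypothesis \<open>homog\<close> says that the ideal is
  homogeneous.\<close>

theorem graded_free_resolution_exists:
  fixes M :: "('a::field) mpoly set"
  assumes M: "ideal M (poly_ring n)" and homog: "\<And>p D. p \<in> M \<Longrightarrow> restr (\<lambda>m. mon_deg m = D) p \<in> M"
  shows "\<exists>F. graded_free_resolution n M F"
proof -
  have Mcar: "p \<in> carrier (poly_ring n)" if "p \<in> M" for p using ideal.Icarr[OF M that] .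
  have M0: "0 \<in> M" using additive_subgroup.zero_closed[OF ideal.axioms(1)[OF M]] by (simp add: poly_ring_ops)
  have Madd: "p + r \<in> M" if "p \<in> M" "r \<in> M" for p r
    using additive_subgroup.a_closed[OF ideal.axioms(1)[OF M] that] by (simp add: poly_ring_ops)
  have Mmult: "a * p \<in> M" if "a \<in> carrier (poly_ring n)" "p \<in> M" for a p
    using ideal.I_l_closed[OF M that(2,1)] by (simp add: poly_ring_ops)
  \<comment> \<open>The ideal, placed in component 0 of a free module of rank one; finite generation
    of submodules then covers the augmentation as well.\<close>
  define N where "N = {v :: nat \<Rightarrow> 'a mpoly. v 0 \<in> M \<and> (\<forall>k>0. v k = 0)}"
  have "graded_submodule n 1 (\<lambda>_. 0) N"
    unfolding graded_submodule_def
  proof (intro conjI ballI allI)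
    show "N \<subseteq> free_mod n 1"
    proof
      fix v assume v: "v \<in> N"
      have "v k \<in> carrier (poly_ring n)" for k
        using v by (cases "k = 0") (auto simp: N_def Mcar carrier_zero)
      then show "v \<in> free_mod n 1" using v by (simp add: free_mod_def N_def)
    qed
  qed (auto simp: N_def M0 Madd Mmult hom_comp_def restr_zero homog)
  from graded_submodule_finitely_generated[OF this] obtain q0 t0 A0 where
    gen0: "\<And>k. k < q0 \<Longrightarrow> A0 k \<in> N \<and> hom_vec (\<lambda>_. 0) (t0 k) (A0 k)" and
    N0: "N = lin_comb q0 A0 ` free_mod n q0"
    by blast
  \<comment> \<open>The invariant of the iteration: the columns are homogeneous for some twists of
    the target, so the kernel is graded and has finitely many homogeneous generators.\<close>
  define ok :: "nat \<times> (nat \<Rightarrow> nat) \<times> (nat \<Rightarrow> nat \<Rightarrow> 'a mpoly) \<Rightarrow> bool" where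
    "ok = (\<lambda>(q, t', A). \<exists>t. \<forall>k<q. hom_vec t (t' k) (A k))"
  define step :: "nat \<times> (nat \<Rightarrow> nat) \<times> (nat \<Rightarrow> nat \<Rightarrow> 'a mpoly) \<Rightarrow> nat \<times> (nat \<Rightarrow> nat) \<times> (nat \<Rightarrow> nat \<Rightarrow> 'a mpoly) \<Rightarrow> bool" where
    "step = (\<lambda>(q, t, A) (q', t', A'). (\<forall>k<q'. A' k \<in> lin_kernel n q A \<and> hom_vec t (t' k) (A' k)) \<and>
       lin_kernel n q A = lin_comb q' A' ` free_mod n q')"
  have "\<exists>y. ok y \<and> step x y" if x: "ok x" for x
  proof -
    obtain q t' A where xe: "x = (q, t', A)" by (cases x)
    then obtain t where t: "\<And>k. k < q \<Longrightarrow> hom_vec t (t' k) (A k)" using x by (auto simp: ok_def)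
    have "graded_submodule n q t' (lin_kernel n q A)"
      using t by (rule graded_submodule_lin_kernel)
    from graded_submodule_finitely_generated[OF this] obtain q2 t2 A2 where "\<forall>k<q2. A2 k \<in> lin_kernel n q A \<and> hom_vec t' (t2 k) (A2 k)"
        "lin_kernel n q A = lin_comb q2 A2 ` free_mod n q2"
      by blast
    then have "ok (q2, t2, A2) \<and> step x (q2, t2, A2)" by (auto simp: ok_def step_def xe)
    then show ?thesis ..
  qed
  then have step_ex: "\<forall>x. \<exists>y. ok x \<longrightarrow> ok y \<and> step x y" by blast
  obtain nx where nx: "\<And>x. ok x \<Longrightarrow> ok (nx x) \<and> step x (nx x)"
    using choice[OF step_ex] by blast
  define X where "X = rec_nat (q0, t0, A0) (\<lambda>_. nx)"
  have X0: "X 0 = (q0, t0, A0)" and XS: "X (Suc i) = nx (X i)" for i by (simp_all add: X_def)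
  have okX: "ok (X i)" for i
    by (induction i) (use gen0 nx in \<open>auto simp: X0 XS ok_def\<close>)
  then have stepX: "step (X i) (X (Suc i))" for i using nx by (simp add: XS)
  define q where "q = (\<lambda>i. fst (X i))"
  define t where "t = (\<lambda>i. fst (snd (X i)))"
  define A where "A = (\<lambda>i. snd (snd (X i)))"
  have base: "q 0 = q0" "t 0 = t0" "A 0 = A0" by (simp_all add: q_def t_def A_def X0)
  have st: "\<And>k. k < q (Suc i) \<Longrightarrow> A (Suc i) k \<in> lin_kernel n (q i) (A i) \<and> hom_vec (t i) (t (Suc i) k) (A (Suc i) k)"
    "lin_kernel n (q i) (A i) = lin_comb (q (Suc i)) (A (Suc i)) ` free_mod n (q (Suc i))" for i
    using stepX[of i] by (auto simp: step_def q_def t_def A_def split: prod.splits)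
  define F where "F = \<lparr>res_rank = q, res_twist = t, res_aug = (\<lambda>k. A0 k 0), res_mat = (\<lambda>i l k. A (Suc i) k l)\<rparr>"
  have F: "res_rank F = q" "res_twist F = t" "res_aug F = (\<lambda>k. A0 k 0)" "res_mat F = (\<lambda>i l k. A (Suc i) k l)"
    by (simp_all add: F_def)
  have mod: "res_module n F i = free_mod n (q i)" for i
    by (simp add: res_module_def free_mod_def F)
  have aug: "res_aug_map F v = lin_comb (q 0) (A 0) v 0" for v
    by (simp add: res_aug_map_def lin_comb_def F base)
  have A0: "A0 k l = 0" if "k < q0" "0 < l" for k l
    using gen0[OF that(1)] that(2) by (auto simp: N_def)
  have aug0: "lin_comb (q 0) (A 0) v = 0 \<longleftrightarrow> res_aug_map F v = 0" for v
  proof -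
    have "lin_comb (q 0) (A 0) v l = 0" if "0 < l" for l
      using A0 that by (simp add: lin_comb_def base)
    then show ?thesis unfolding aug fun_eq_iff by (metis gr0I zero_fun_apply)
  qed
  \<comment> \<open>\<open>res_diff\<close> cuts off at the rank of the target; the columns vanish
    there anyway, as elements of a kernel inside the free module of rank \<open>q i\<close>.\<close>
  have diff: "res_diff F i v = lin_comb (q (Suc i)) (A (Suc i)) v" for i v
  proof
    fix l
    have "A (Suc i) k l = 0" if "k < q (Suc i)" "\<not> l < q i" for k
      using st(1)[OF that(1)] that(2) by (auto simp: lin_kernel_def free_mod_def)
    then show "res_diff F i v l = lin_comb (q (Suc i)) (A (Suc i)) v l"
      by (auto simp: res_diff_def lin_comb_def F mult.commute)
  qed
  have "graded_free_resolution n M F"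
    unfolding graded_free_resolution_def
  proof (intro conjI allI impI)
    fix k assume "k < res_rank F 0"
    then have "A0 k \<in> N" "hom_vec (\<lambda>_. 0) (t0 k) (A0 k)" using gen0 by (auto simp: F base)
    then show "res_aug F k \<in> M" "homogeneous (res_twist F 0 k) (res_aug F k)"
      by (auto simp: F N_def hom_vec_def homogeneous_def base)
  next
    fix i l k assume k: "k < res_rank F (Suc i)"
    then show "res_mat F i l k \<in> carrier (poly_ring n)"
      using st(1)[of k i] by (simp add: F lin_kernel_def free_mod_def)
    show "\<forall>m\<in>Poly_Mapping.keys (res_mat F i l k). mon_deg m + res_twist F i l = res_twist F (Suc i) k"
      using st(1)[of k i] k by (simp add: F hom_vec_def)
  next
    have "(\<lambda>v. v 0) ` N = M"
    proof
      show "M \<subseteq> (\<lambda>v. v 0) ` N"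
      proof
        fix p assume "p \<in> M"
        then show "p \<in> (\<lambda>v. v 0) ` N"
          by (intro image_eqI[of _ _ "\<lambda>k. if k = 0 then p else 0"]) (auto simp: N_def)
      qed
    qed (auto simp: N_def)
    then show "res_aug_map F ` res_module n F 0 = M"
      by (simp add: N0 image_image aug mod base)
  next
    show "{v \<in> res_module n F 0. res_aug_map F v = 0} = res_diff F 0 ` res_module n F 1"
      using st(2)[of 0] by (simp add: mod aug0 lin_kernel_def diff)
  next
    fix i
    show "{v \<in> res_module n F (Suc i). res_diff F i v = 0} = res_diff F (Suc i) ` res_module n F (Suc (Suc i))"
      using st(2)[of "Suc i"] by (simp add: mod lin_kernel_def diff)
  qed
  then show ?thesis ..
qed

section \<open>A criterion for nonvanishing of the first Tor\<close>

interpretation fun_space: vector_space "\<lambda>(c::'a::field) (v::nat \<Rightarrow> 'a) k. c * v k"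
  by unfold_locales (auto simp: fun_eq_iff algebra_simps)

text \<open>A maximal independent subset of \<open>V\<close> stays independent when \<open>w\<close>
  is added and extends to a basis of \<open>W\<close>. The finite spanning set guarantees that the
  cardinalities compared are finite, since an infinite set would have \<open>card\<close> 0.\<close>

lemma vec_dim_less:
  fixes V W :: "(nat \<Rightarrow> 'a::field) set"
  assumes VW: "V \<subseteq> W" and w: "w \<in> W" "w \<notin> fun_space.span V"
    and B: "finite B" "W \<subseteq> fun_space.span B"
  shows "vec_dim V < vec_dim W"
proof -
  obtain C where C: "C \<subseteq> V" "fun_space.independent C" "V \<subseteq> fun_space.span C"
    using fun_space.maximal_independent_subset by blast
  have "w \<notin> fun_space.span C"
    using w(2) C(1) fun_space.span_mono by blast
  then have ind: "fun_space.independent (insert w C)"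
    using C(2) by (rule fun_space.independent_insertI)
  have "insert w C \<subseteq> W" using C(1) VW w(1) by blast
  then obtain D where D: "insert w C \<subseteq> D" "D \<subseteq> W" "fun_space.independent D" "W \<subseteq> fun_space.span D"
    using fun_space.maximal_independent_subset_extend[OF _ ind] by blast
  have "finite D"
    using fun_space.independent_span_bound[OF B(1) D(3)] D(2) B(2) by blast
  moreover have "w \<notin> C" using w(2) C(1) fun_space.span_base by blast
  ultimately have "card C < card D"
    using D(1) by (intro psubset_card_mono) auto
  moreover have "fun_space.dim V = card C" "fun_space.dim W = card D"
    using fun_space.basis_card_eq_dim C D by metis+
  ultimately show ?thesis by (simp add: vec_dim_def)
qed

lemma tensor_module_finite_span:
  "\<exists>B. finite B \<and> tensor_module F i j \<subseteq> fun_space.span B"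
proof (intro exI conjI subsetI)
  let ?B = "(\<lambda>k l. if l = k then 1 else 0) ` {..<res_rank F i}"
  show "finite ?B" by simp
  fix v :: "nat \<Rightarrow> 'a" assume v: "v \<in> tensor_module F i j"
  have "v = (\<Sum>k<res_rank F i. (\<lambda>l. v k * (if l = k then 1 else 0)))"
  proof
    fix l
    have "(\<Sum>k<res_rank F i. (\<lambda>l. v k * (if l = k then 1 else 0))) l = (\<Sum>k<res_rank F i. v k * (if l = k then 1 else 0))"
      by (simp add: sum_fun_apply)
    also have "\<dots> = (\<Sum>k<res_rank F i. if k = l then v l else 0)"
      by (intro sum.cong) auto
    also have "\<dots> = v l"
      using v by (auto simp: tensor_module_def)
    finally show "v l = (\<Sum>k<res_rank F i. (\<lambda>l. v k * (if l = k then 1 else 0))) l" ..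
  qed
  moreover have "(\<Sum>k<res_rank F i. (\<lambda>l. v k * (if l = k then 1 else 0))) \<in> fun_space.span ?B"
    by (intro fun_space.span_sum fun_space.span_scale fun_space.span_base) auto
  ultimately show "v \<in> fun_space.span ?B" by simp
qed

text \<open>In multidegree \<open>X\<close>, \<open>Tor\<^sub>1\<close> of a monomial ideal is the reduced zeroth homology of the
  upper Koszul complex; \<open>T\<close> separates two of its components, and \<open>\<phi>\<close> in the proof is
  the corresponding functional on syzygies.\<close>

theorem tor_dim_one_nonzero:
  fixes M :: "('a::field) mpoly set" and F :: "'a resolution"
  assumes F: "graded_free_resolution n M F"
    and X: "Poly_Mapping.keys X \<subseteq> {1..n}"
    and sep: "\<And>Y. mon_dvd Y X \<Longrightarrow> Y \<noteq> X \<Longrightarrow>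
      (\<forall>p\<in>M. \<forall>b\<in>Poly_Mapping.keys p. mon_dvd b Y \<longrightarrow> b \<in> T) \<or>
      (\<forall>p\<in>M. \<forall>b\<in>Poly_Mapping.keys p. mon_dvd b Y \<longrightarrow> b \<notin> T)"
    and u: "Poly_Mapping.single u 1 \<in> M" "mon_dvd u X" "u \<noteq> X" "u \<in> T"
    and v: "Poly_Mapping.single v 1 \<in> M" "mon_dvd v X" "v \<noteq> X" "v \<notin> T"
  shows "tor_dim F 1 (mon_deg X) \<noteq> 0"
proof -
  define r where "r = res_rank F"
  define t where "t = res_twist F"
  define A where "A = res_aug F"
  define mat where "mat = res_mat F"
  let ?c = "\<lambda>p :: 'a mpoly. Poly_Mapping.lookup p 0"
  have aug_M: "A k \<in> M" "b \<in> Poly_Mapping.keys (A k) \<Longrightarrow> mon_deg b = t 0 k" if "k < r 0" for k b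
    using F that by (auto simp: graded_free_resolution_def homogeneous_def r_def t_def A_def)
  have mat: "mat i l k \<in> carrier (poly_ring n)"
    "a \<in> Poly_Mapping.keys (mat i l k) \<Longrightarrow> mon_deg a + t i l = t (Suc i) k" if "l < r i" "k < r (Suc i)" for i l k a
    using F that by (auto simp: graded_free_resolution_def r_def t_def mat_def)
  have aug_surj: "res_aug_map F ` res_module n F 0 = M"
    and exact0: "{v \<in> res_module n F 0. res_aug_map F v = 0} = res_diff F 0 ` res_module n F 1"
    and exact: "{v \<in> res_module n F (Suc i). res_diff F i v = 0} = res_diff F (Suc i) ` res_module n F (Suc (Suc i))" for i
    using F by (auto simp: graded_free_resolution_def)
  have const_mat: "t i l = t (Suc i) k" if "l < r i" "k < r (Suc i)" "?c (mat i l k) \<noteq> 0" for i l k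
    using mat(2)[OF that(1,2), of 0] that(3) by (simp add: in_keys_iff mon_deg_zero)
  define unit where "unit = (\<lambda>(k::nat) l. if l = k then 1 :: 'a mpoly else 0)"
  have unit_mod: "unit k \<in> res_module n F i" if "k < r i" for i k
    using that by (auto simp: res_module_def unit_def r_def carrier_poly_ring)
  have diff_unit: "res_diff F i (unit k) = (\<lambda>l. if l < r i then mat i l k else 0)" if "k < r (Suc i)" for i k
  proof
    fix l
    have "(\<Sum>k'<r (Suc i). mat i l k' * unit k k') = (\<Sum>k'<r (Suc i). if k' = k then mat i l k else 0)"
      by (intro sum.cong) (auto simp: unit_def)
    then show "res_diff F i (unit k) l = (if l < r i then mat i l k else 0)"
      using that by (simp add: res_diff_def r_def mat_def)
  qed
  \<comment> \<open>The generating syzygies: \<open>z k\<close> is the image of the k-th basis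
    vector of the first module.\<close>
  define z where "z = (\<lambda>k l. if l < r 0 then mat 0 l k else 0)"
  have z_syz: "res_aug_map F (z k) = 0" if "k < r 1" for k
  proof -
    have "res_diff F 0 (unit k) \<in> {v \<in> res_module n F 0. res_aug_map F v = 0}"
      unfolding exact0 using unit_mod[of k 1] that by (intro imageI)
    then show ?thesis using diff_unit[of k 0] that by (simp add: z_def)
  qed
  have comp_zero: "(\<Sum>k<r 1. mat 1 k h * z k l) = 0" if "h < r 2" "l < r 0" for h l
  proof -
    have "res_diff F (Suc 0) (unit h) \<in> {v \<in> res_module n F (Suc 0). res_diff F 0 v = 0}"
      unfolding exact using unit_mod[of h 2] that(1) by (intro imageI) (simp add: numeral_2_eq_2)
    then have "res_diff F 0 (res_diff F 1 (unit h)) l = 0" by (simp add: fun_eq_iff)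
    then show ?thesis
      using diff_unit[of h 1] that
      by (simp add: numeral_2_eq_2 res_diff_def[of F 0] z_def mult.commute r_def mat_def)
  qed
  \<comment> \<open>The augmentation with every generator cut down to its monomials in
    \<open>T\<close>. On a syzygy the full sum cancels, so the coefficient of \<open>\<Phi>\<close>
    at \<open>X\<close> measures cancellation between terms inside and outside
    \<open>T\<close>.\<close>
  define \<Phi> where "\<Phi> = (\<lambda>f :: nat \<Rightarrow> 'a mpoly. \<Sum>k<r 0. f k * restr (\<lambda>b. b \<in> T) (A k))"
  define \<phi> where "\<phi> = (\<lambda>f. Poly_Mapping.lookup (\<Phi> f) X)"
  have Phi_in: "Poly_Mapping.lookup (\<Phi> f) Y = Poly_Mapping.lookup (res_aug_map F f) Y"
    if all: "\<forall>p\<in>M. \<forall>b\<in>Poly_Mapping.keys p. mon_dvd b Y \<longrightarrow> b \<in> T" for f Y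
  proof -
    have "Poly_Mapping.lookup (f k * restr (\<lambda>b. b \<in> T) (A k)) Y = Poly_Mapping.lookup (f k * A k) Y"
      if k: "k < r 0" for k
    proof (rule lookup_mult_cong)
      fix a b assume "Y = a + b"
      then have "mon_dvd b Y" by (auto simp: mon_dvd_def lookup_add)
      then have "b \<in> T \<or> b \<notin> Poly_Mapping.keys (A k)"
        using all aug_M(1)[OF k] by blast
      then show "Poly_Mapping.lookup (f k) a * Poly_Mapping.lookup (restr (\<lambda>b. b \<in> T) (A k)) b =
          Poly_Mapping.lookup (f k) a * Poly_Mapping.lookup (A k) b"
        by (auto simp: lookup_restr in_keys_iff when_def)
    qed
    then show ?thesis by (simp add: \<Phi>_def res_aug_map_def lookup_sum r_def A_def)
  qed
  have Phi_out: "Poly_Mapping.lookup (\<Phi> f) Y = 0"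
    if all: "\<forall>p\<in>M. \<forall>b\<in>Poly_Mapping.keys p. mon_dvd b Y \<longrightarrow> b \<notin> T" for f Y
  proof -
    have "Poly_Mapping.lookup (f k * restr (\<lambda>b. b \<in> T) (A k)) Y = Poly_Mapping.lookup (f k * 0) Y"
      if k: "k < r 0" for k
    proof (rule lookup_mult_cong)
      fix a b assume "Y = a + b"
      then have "mon_dvd b Y" by (auto simp: mon_dvd_def lookup_add)
      then have "b \<notin> T \<or> b \<notin> Poly_Mapping.keys (A k)"
        using all aug_M(1)[OF k] by blast
      then show "Poly_Mapping.lookup (f k) a * Poly_Mapping.lookup (restr (\<lambda>b. b \<in> T) (A k)) b =
          Poly_Mapping.lookup (f k) a * Poly_Mapping.lookup 0 b"
        by (auto simp: lookup_restr in_keys_iff when_def)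
    qed
    then show ?thesis by (simp add: \<Phi>_def lookup_sum)
  qed
  \<comment> \<open>Below a proper divisor of \<open>X\<close> only one of the two classes occurs,
    so the cut sum agrees at that coefficient either with the augmentation or with zero.\<close>
  have Phi_syz: "Poly_Mapping.lookup (\<Phi> f) Y = 0"
    if "res_aug_map F f = 0" "mon_dvd Y X" "Y \<noteq> X" for f Y
    using sep[OF that(2,3)] Phi_in[of Y f] Phi_out[of Y f] that(1) by auto
  \<comment> \<open>A nonconstant monomial of \<open>p\<close> meets a coefficient of
    \<open>\<Phi> f\<close> at a proper divisor of \<open>X\<close>, which is zero. Hence \<phi>
    kills the maximal ideal times the syzygy module and induces a functional on Tor.\<close>
  have phi_mult: "\<phi> (\<lambda>l. p * f l) = ?c p * \<phi> f" if f: "res_aug_map F f = 0" for p f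
  proof -
    have "\<Phi> (\<lambda>l. p * f l) = p * \<Phi> f"
      by (simp add: \<Phi>_def sum_distrib_left mult.assoc)
    moreover have "Poly_Mapping.lookup (p * \<Phi> f) X =
        Poly_Mapping.lookup (Poly_Mapping.single 0 (?c p) * \<Phi> f) X"
    proof (rule lookup_mult_cong)
      fix a b assume ab: "X = a + b"
      show "Poly_Mapping.lookup p a * Poly_Mapping.lookup (\<Phi> f) b =
          Poly_Mapping.lookup (Poly_Mapping.single 0 (?c p)) a * Poly_Mapping.lookup (\<Phi> f) b"
      proof (cases "a = 0")
        case False
        then have "b \<noteq> X" "mon_dvd b X" using ab by (auto simp: mon_dvd_def lookup_add)
        then show ?thesis using Phi_syz[OF f] by simp
      qed simp
    qed
    ultimately show ?thesis
      using lookup_single_mult[of 0 "?c p" "\<Phi> f" X] by (simp add: \<phi>_def)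
  qed
  have phi_sum: "\<phi> (\<lambda>l. \<Sum>k<m. g k l) = (\<Sum>k<m. \<phi> (g k))" for m and g :: "nat \<Rightarrow> nat \<Rightarrow> 'a mpoly"
  proof -
    have "\<Phi> (\<lambda>l. \<Sum>k<m. g k l) = (\<Sum>k<m. \<Phi> (g k))"
      by (simp add: \<Phi>_def sum_distrib_right) (rule sum.swap)
    then show ?thesis by (simp add: \<phi>_def lookup_sum)
  qed
  have phi_cong: "\<phi> f = \<phi> g" if "\<And>l. l < r 0 \<Longrightarrow> f l = g l" for f g
    using that by (simp add: \<phi>_def \<Phi>_def)
  have phi_comb: "\<phi> (\<lambda>l. \<Sum>k<r 1. g k * z k l) = (\<Sum>k<r 1. ?c (g k) * \<phi> (z k))" for g
    using z_syz by (simp add: phi_sum phi_mult)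
  \<comment> \<open>Total degree is the only grading at hand, but it suffices here: a contribution
    to the coefficient at \<open>X\<close> fixes the degree of the basis vector.\<close>
  have phi_z: "t 1 k = mon_deg X" if k: "k < r 1" and nz: "\<phi> (z k) \<noteq> 0" for k
  proof -
    obtain l where l: "l < r 0" "Poly_Mapping.lookup (z k l * restr (\<lambda>b. b \<in> T) (A l)) X \<noteq> 0"
      using nz unfolding \<phi>_def \<Phi>_def lookup_sum by (meson lessThan_iff sum.neutral)
    then obtain a b where "a \<in> Poly_Mapping.keys (mat 0 l k)" "b \<in> Poly_Mapping.keys (A l)" "X = a + b"
      using keys_mult[of "z k l" "restr (\<lambda>b. b \<in> T) (A l)"] by (auto simp: in_keys_iff z_def lookup_restr)
    then show ?thesis
      using mat(2)[of l 0 k a] aug_M(2)[OF l(1), of b] l(1) k by (simp add: mon_deg_add)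
  qed
  have "Poly_Mapping.single u 1 \<in> res_aug_map F ` res_module n F 0"
    "Poly_Mapping.single v 1 \<in> res_aug_map F ` res_module n F 0"
    unfolding aug_surj by (fact u(1), fact v(1))
  then obtain fu fv where fu: "fu \<in> res_module n F 0" "res_aug_map F fu = Poly_Mapping.single u 1"
    and fv: "fv \<in> res_module n F 0" "res_aug_map F fv = Poly_Mapping.single v 1"
    by (elim imageE) simp
  obtain a where a: "X = u + a" using u(2) unfolding mon_dvd_iff ..
  obtain b where b: "X = v + b" using v(2) unfolding mon_dvd_iff ..
  have ab0: "a \<noteq> 0" "b \<noteq> 0" using a u(3) b v(3) by (metis add.right_neutral)+
  \<comment> \<open>The syzygy X/u times a lift of \<open>u\<close> minus X/v times a lift of
    \<open>v\<close>. Lifts are necessary because \<open>u\<close> and \<open>v\<close> need not be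
    among the chosen generators.\<close>
  define \<sigma> where "\<sigma> = (\<lambda>l. Poly_Mapping.single a 1 * fu l - Poly_Mapping.single b 1 * fv l)"
  have aug_\<sigma>: "res_aug_map F \<sigma> = 0"
  proof -
    have "res_aug_map F \<sigma> = Poly_Mapping.single a 1 * res_aug_map F fu - Poly_Mapping.single b 1 * res_aug_map F fv"
      by (simp add: res_aug_map_def \<sigma>_def left_diff_distrib sum_subtractf sum_distrib_left mult.assoc)
    also have "\<dots> = 0" using a b by (simp add: fu fv mult_single add.commute)
    finally show ?thesis .
  qed
  have keys_ab: "Poly_Mapping.keys a \<subseteq> {1..n}" "Poly_Mapping.keys b \<subseteq> {1..n}"
    using X a b by (metis keys_add_nat le_sup_iff)+
  have carrier_diff: "p - q \<in> carrier (poly_ring n)"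
    if "p \<in> carrier (poly_ring n)" "q \<in> carrier (poly_ring n)" for p q :: "'a mpoly"
    using that keys_diff[of p q] unfolding carrier_poly_ring by blast
  have \<sigma>_mod: "\<sigma> \<in> res_module n F 0"
    using fu(1) fv(1) keys_ab unfolding \<sigma>_def res_module_def
    by (auto intro!: carrier_diff carrier_mult carrier_single)
  \<comment> \<open>At \<open>u\<close> everything of \<open>M\<close> lies in \<open>T\<close>, so
    the first lift contributes its full coefficient 1; at \<open>v\<close> nothing does, so the
    second contributes 0.\<close>
  have phi_\<sigma>: "\<phi> \<sigma> = 1"
  proof -
    have "\<Phi> \<sigma> = Poly_Mapping.single a 1 * \<Phi> fu - Poly_Mapping.single b 1 * \<Phi> fv"
      by (simp add: \<Phi>_def \<sigma>_def left_diff_distrib sum_subtractf sum_distrib_left mult.assoc)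
    then have "\<phi> \<sigma> = Poly_Mapping.lookup (Poly_Mapping.single a 1 * \<Phi> fu) (a + u) -
        Poly_Mapping.lookup (Poly_Mapping.single b 1 * \<Phi> fv) (b + v)"
      using a b by (simp add: \<phi>_def lookup_minus add.commute)
    also have "\<dots> = Poly_Mapping.lookup (\<Phi> fu) u - Poly_Mapping.lookup (\<Phi> fv) v"
      by (simp add: lookup_single_mult)
    also have "Poly_Mapping.lookup (\<Phi> fu) u = 1"
    proof -
      have "u \<in> Poly_Mapping.keys (Poly_Mapping.single u (1::'a))" "mon_dvd u u" by (auto simp: mon_dvd_def)
      then have "\<forall>p\<in>M. \<forall>b\<in>Poly_Mapping.keys p. mon_dvd b u \<longrightarrow> b \<in> T"
        using sep[OF u(2,3)] u(1,4) by blast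
      from Phi_in[OF this, of fu] show ?thesis by (simp add: fu)
    qed
    also have "Poly_Mapping.lookup (\<Phi> fv) v = 0"
    proof -
      have "v \<in> Poly_Mapping.keys (Poly_Mapping.single v (1::'a))" "mon_dvd v v" by (auto simp: mon_dvd_def)
      then have "\<forall>p\<in>M. \<forall>b\<in>Poly_Mapping.keys p. mon_dvd b v \<longrightarrow> b \<notin> T"
        using sep[OF v(2,3)] v(1,4) by blast
      from Phi_out[OF this, of fv] show ?thesis .
    qed
    finally show ?thesis by simp
  qed
  obtain w where w: "w \<in> res_module n F 1" "\<sigma> = res_diff F 0 w"
    using exact0 \<sigma>_mod aug_\<sigma> by blast
  have \<sigma>_eq: "\<sigma> l = (\<Sum>k<r 1. mat 0 l k * w k)" if "l < r 0" for l
    using that by (simp add: w(2) res_diff_def r_def mat_def)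
  \<comment> \<open>The class of \<sigma> in Tor: write \<sigma> through the generating syzygies,
    reduce to constants and keep the part of degree \<open>mon_deg X\<close>. The discarded
    coordinates do not affect \<open>\<psi>\<close>, by \<open>phi_z\<close>.\<close>
  define wc where "wc = (\<lambda>k. if k < r 1 \<and> t 1 k = mon_deg X then ?c (w k) else 0)"
  define \<psi> where "\<psi> = (\<lambda>x :: nat \<Rightarrow> 'a. \<Sum>k<r 1. x k * \<phi> (z k))"
  have psi_wc: "\<psi> wc = 1"
  proof -
    have "\<psi> wc = (\<Sum>k<r 1. ?c (w k) * \<phi> (z k))"
      unfolding \<psi>_def wc_def using phi_z by (intro sum.cong) auto
    also have "\<dots> = \<phi> (\<lambda>l. \<Sum>k<r 1. w k * z k l)"
      by (rule phi_comb[symmetric])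
    also have "\<dots> = \<phi> \<sigma>"
      by (rule phi_cong) (simp add: \<sigma>_eq z_def mult.commute)
    finally show ?thesis using phi_\<sigma> by simp
  qed
  \<comment> \<open>Constant matrix entries join only basis vectors of equal degree, so truncation
    by degree commutes with the differential; what remains is the constant coefficient of \<sigma>,
    zero because X/u and X/v are nonconstant.\<close>
  have wc_cycle: "wc \<in> tensor_cycles F 1 (mon_deg X)"
  proof -
    have "wc \<in> tensor_module F 1 (mon_deg X)"
      by (auto simp: tensor_module_def wc_def r_def t_def split: if_splits)
    moreover have "tensor_diff F 0 wc l = 0" for l
    proof (cases "l < r 0")
      case True
      have "(\<Sum>k<r 1. ?c (mat 0 l k) * wc k) = (if t 0 l = mon_deg X then \<Sum>k<r 1. ?c (mat 0 l k) * ?c (w k) else 0)"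
      proof -
        have "?c (mat 0 l k) * wc k = (if t 0 l = mon_deg X then ?c (mat 0 l k) * ?c (w k) else 0)" if "k < r 1" for k
          using const_mat[of l 0 k] True that by (cases "?c (mat 0 l k) = 0") (auto simp: wc_def)
        then show ?thesis by simp
      qed
      also have "(\<Sum>k<r 1. ?c (mat 0 l k) * ?c (w k)) = ?c (\<sigma> l)"
        using True by (simp add: \<sigma>_eq lookup_sum lookup_mult_zero)
      also have "?c (\<sigma> l) = 0"
        using ab0 by (simp add: \<sigma>_def lookup_minus lookup_mult_zero lookup_single when_def)
      finally show ?thesis using True by (simp add: tensor_diff_def r_def mat_def)
    qed (simp add: tensor_diff_def r_def)
    ultimately show ?thesis by (auto simp: tensor_cycles_def fun_eq_iff)
  qed
  \<comment> \<open>By \<open>phi_comb\<close>, \<open>\<psi>\<close> of a boundary is a combination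
    of values of \<phi> on composites of two consecutive differentials, and these composites
    vanish.\<close>
  have psi_bd: "\<psi> x = 0" if "x \<in> tensor_boundaries F 1 (mon_deg X)" for x
  proof -
    obtain y where y: "x = tensor_diff F 1 y" using \<open>x \<in> _\<close> by (auto simp: tensor_boundaries_def)
    have "\<psi> x = (\<Sum>k<r 1. \<Sum>h<r 2. ?c (mat 1 k h) * y h * \<phi> (z k))"
      by (simp add: \<psi>_def y tensor_diff_def r_def mat_def sum_distrib_right numeral_2_eq_2)
    also have "\<dots> = (\<Sum>h<r 2. y h * (\<Sum>k<r 1. ?c (mat 1 k h) * \<phi> (z k)))"
      by (subst sum.swap) (simp add: sum_distrib_left mult_ac)
    also have "\<dots> = (\<Sum>h<r 2. y h * \<phi> (\<lambda>l. \<Sum>k<r 1. mat 1 k h * z k l))"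
      by (simp only: phi_comb)
    also have "\<dots> = (\<Sum>h<r 2. y h * \<phi> (\<lambda>l. 0))"
      using comp_zero by (intro sum.cong refl arg_cong2[where f = "(*)"] phi_cong) auto
    also have "\<dots> = 0" by (simp add: \<phi>_def \<Phi>_def)
    finally show ?thesis .
  qed
  have bd_cycle: "tensor_boundaries F 1 (mon_deg X) \<subseteq> tensor_cycles F 1 (mon_deg X)"
  proof
    fix x assume "x \<in> tensor_boundaries F 1 (mon_deg X)"
    then obtain y where y: "x = tensor_diff F 1 y" "y \<in> tensor_module F 2 (mon_deg X)"
      by (auto simp: tensor_boundaries_def numeral_2_eq_2)
    have "x \<in> tensor_module F 1 (mon_deg X)"
      unfolding tensor_module_def
    proof (intro CollectI allI impI)
      fix k assume k: "x k \<noteq> 0"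
      then have k1: "k < r 1" and "(\<Sum>h<r 2. ?c (mat 1 k h) * y h) \<noteq> 0"
        by (auto simp: y tensor_diff_def r_def mat_def numeral_2_eq_2 split: if_splits)
      then obtain h where h: "h < r 2" "?c (mat 1 k h) * y h \<noteq> 0"
        by (meson lessThan_iff sum.neutral)
      then have "t 2 h = mon_deg X" using y(2) by (auto simp: tensor_module_def t_def)
      moreover have "t 1 k = t 2 h" using const_mat[of k 1 h] k1 h by (simp add: numeral_2_eq_2)
      ultimately show "k < res_rank F 1 \<and> res_twist F 1 k = mon_deg X" using k1 by (simp add: r_def t_def)
    qed
    moreover have "tensor_diff F 0 x l = 0" for l
    proof (cases "l < r 0")
      case True
      have "tensor_diff F 0 x l = (\<Sum>k<r 1. \<Sum>h<r 2. ?c (mat 0 l k) * (?c (mat 1 k h) * y h))"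
        using True by (simp add: y tensor_diff_def r_def mat_def sum_distrib_left numeral_2_eq_2)
      also have "\<dots> = (\<Sum>h<r 2. y h * (\<Sum>k<r 1. ?c (mat 1 k h) * ?c (mat 0 l k)))"
        by (subst sum.swap) (simp add: sum_distrib_left mult_ac)
      also have "\<dots> = (\<Sum>h<r 2. y h * ?c (\<Sum>k<r 1. mat 1 k h * z k l))"
        using True by (simp add: lookup_sum lookup_mult_zero z_def)
      also have "\<dots> = 0" using comp_zero True by simp
      finally show ?thesis .
    qed (simp add: tensor_diff_def r_def)
    ultimately show "x \<in> tensor_cycles F 1 (mon_deg X)"
      by (auto simp: tensor_cycles_def fun_eq_iff)
  qed
  have "fun_space.subspace {x. \<psi> x = 0}"
    by (rule fun_space.subspaceI)
      (simp_all add: \<psi>_def distrib_right sum.distrib mult.assoc flip: sum_distrib_left)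
  then have "fun_space.span (tensor_boundaries F 1 (mon_deg X)) \<subseteq> {x. \<psi> x = 0}"
    using psi_bd by (intro fun_space.span_minimal) auto
  then have "wc \<notin> fun_space.span (tensor_boundaries F 1 (mon_deg X))"
    using psi_wc by auto
  moreover obtain B where "finite B" "tensor_cycles F 1 (mon_deg X) \<subseteq> fun_space.span B"
    using tensor_module_finite_span[of F 1 "mon_deg X"] by (auto simp: tensor_cycles_def)
  ultimately have "vec_dim (tensor_boundaries F 1 (mon_deg X)) < vec_dim (tensor_cycles F 1 (mon_deg X))"
    by (rule vec_dim_less[OF bd_cycle wc_cycle])
  then show ?thesis by (simp add: tor_dim_def)
qed

section \<open>Monomial ideals\<close>

text \<open>Described by the exponents allowed in the support rather than by generators, so that
  intersections of ideals become conjunctions of conditions on exponents. It is an ideal once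
  \<open>U\<close> is closed under adding exponents.\<close>

definition mon_ideal :: "nat \<Rightarrow> (nat \<Rightarrow>\<^sub>0 nat) set \<Rightarrow> ('a::field) mpoly set" where
  "mon_ideal n U = {p \<in> carrier (poly_ring n). Poly_Mapping.keys p \<subseteq> U}"

lemma ideal_mon_ideal:
  assumes U: "\<And>a b. b \<in> U \<Longrightarrow> a + b \<in> U"
  shows "ideal (mon_ideal n U :: ('a::field) mpoly set) (poly_ring n)"
proof -
  let ?R = "poly_ring n :: 'a mpoly ring"
  interpret cring ?R by (rule cring_poly_ring)
  have neg: "\<ominus>\<^bsub>?R\<^esub> p = - p" if "p \<in> carrier ?R" for p
    using that by (intro minus_equality) (auto simp: poly_ring_ops carrier_poly_ring)
  have mult: "q * p \<in> mon_ideal n U" if "p \<in> mon_ideal n U" "q \<in> carrier ?R" for p q :: "'a mpoly"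
  proof -
    have "Poly_Mapping.keys (q * p) \<subseteq> U"
      using keys_mult[of q p] that(1) U by (fastforce simp: mon_ideal_def)
    then show ?thesis using that by (simp add: mon_ideal_def carrier_mult)
  qed
  then have mult': "p * q \<in> mon_ideal n U" if "p \<in> mon_ideal n U" "q \<in> carrier ?R" for p q :: "'a mpoly"
    using that by (simp add: mult.commute[of p q])
  show ?thesis
  proof (rule idealI)
    show "ring ?R" by (rule ring_axioms)
    show "subgroup (mon_ideal n U) (add_monoid ?R)"
    proof (rule subgroup.intro)
      fix p q :: "'a mpoly" assume "p \<in> mon_ideal n U" "q \<in> mon_ideal n U"
      then show "p \<otimes>\<^bsub>add_monoid ?R\<^esub> q \<in> mon_ideal n U"
        using keys_add[of p q] by (auto simp: mon_ideal_def poly_ring_ops carrier_add)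
    next
      fix p :: "'a mpoly" assume p: "p \<in> mon_ideal n U"
      then have "\<ominus>\<^bsub>?R\<^esub> p = - p" using neg by (simp add: mon_ideal_def)
      then show "inv\<^bsub>add_monoid ?R\<^esub> p \<in> mon_ideal n U"
        using p by (simp add: a_inv_def mon_ideal_def carrier_poly_ring)
    qed (auto simp: mon_ideal_def poly_ring_ops carrier_zero)
  qed (auto simp: poly_ring_ops mult mult')
qed

text \<open>A polynomial is a combination of the monomials in its support, so containment needs
  checking on monomials with coefficient 1 only.\<close>

lemma mon_ideal_subset:
  fixes J :: "('a::field) mpoly set"
  assumes J: "ideal J (poly_ring n)"
    and U: "\<And>m. m \<in> U \<Longrightarrow> Poly_Mapping.keys m \<subseteq> {1..n} \<Longrightarrow> Poly_Mapping.single m 1 \<in> J"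
  shows "mon_ideal n U \<subseteq> J"
proof
  fix p :: "'a mpoly" assume p: "p \<in> mon_ideal n U"
  have add: "x + y \<in> J" if "x \<in> J" "y \<in> J" for x y
    using additive_subgroup.a_closed[OF ideal.axioms(1)[OF J] that] by (simp add: poly_ring_ops)
  have zero: "0 \<in> J"
    using additive_subgroup.zero_closed[OF ideal.axioms(1)[OF J]] by (simp add: poly_ring_ops)
  have sum: "sum f I \<in> J" if "\<And>i. i \<in> I \<Longrightarrow> f i \<in> J" for f and I :: "(nat \<Rightarrow>\<^sub>0 nat) set"
    using that by (induction I rule: infinite_finite_induct) (auto simp: add zero)
  have "Poly_Mapping.single m (Poly_Mapping.lookup p m) \<in> J" if m: "m \<in> Poly_Mapping.keys p" for m
  proof -
    have "Poly_Mapping.single m 1 \<in> J"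
      using p m by (intro U) (auto simp: mon_ideal_def carrier_poly_ring)
    moreover have "Poly_Mapping.single 0 (Poly_Mapping.lookup p m) \<in> carrier (poly_ring n)"
      by (rule carrier_single) simp
    ultimately have "Poly_Mapping.single 0 (Poly_Mapping.lookup p m) * Poly_Mapping.single m 1 \<in> J"
      using ideal.I_l_closed[OF J] by (auto simp: poly_ring_ops)
    then show ?thesis by (simp add: mult_single)
  qed
  then show "p \<in> J" by (subst poly_eq_sum_single) (rule sum)
qed

lemma single_in_mon_ideal:
  "m \<in> U \<Longrightarrow> Poly_Mapping.keys m \<subseteq> {1..n} \<Longrightarrow> Poly_Mapping.single m 1 \<in> mon_ideal n U"
  by (simp add: mon_ideal_def carrier_single)

lemma restr_mon_ideal: "p \<in> mon_ideal n U \<Longrightarrow> restr P p \<in> mon_ideal n U"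
  by (auto simp: mon_ideal_def carrier_restr keys_restr)

section \<open>Symbolic powers and degree components as monomial ideals\<close>

definition degree_on :: "nat set \<Rightarrow> (nat \<Rightarrow>\<^sub>0 nat) \<Rightarrow> nat" where
  "degree_on C m = (\<Sum>i\<in>C. Poly_Mapping.lookup m i)"

lemma degree_on_add: "degree_on C (a + b) = degree_on C a + degree_on C b"
  by (simp add: degree_on_def lookup_add sum.distrib)

lemma cover_prime_eq:
  assumes "C \<subseteq> {1..n}"
  shows "cover_prime n C = (mon_ideal n {m. 1 \<le> degree_on C m} :: ('a::field) mpoly set)"
proof -
  let ?R = "poly_ring n :: 'a mpoly ring"
  interpret cring ?R by (rule cring_poly_ring)
  have fin: "finite C" using assms finite_subset by blast
  have var: "(var ` C :: 'a mpoly set) \<subseteq> carrier ?R"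
    using assms by (auto simp: var_def carrier_poly_ring)
  have deg_var: "1 \<le> degree_on C (Poly_Mapping.single i 1)" if "i \<in> C" for i
    using fin that by (simp add: degree_on_def lookup_single when_def)
  show ?thesis
    unfolding cover_prime_def
  proof
    show "Idl\<^bsub>?R\<^esub> (var ` C) \<subseteq> mon_ideal n {m. 1 \<le> degree_on C m}"
    proof (rule genideal_minimal)
      show "ideal (mon_ideal n {m. 1 \<le> degree_on C m} :: 'a mpoly set) ?R"
        by (rule ideal_mon_ideal) (simp add: degree_on_add)
      show "var ` C \<subseteq> (mon_ideal n {m. 1 \<le> degree_on C m} :: 'a mpoly set)"
        using var deg_var by (auto simp: mon_ideal_def) (auto simp: var_def)
    qed
    show "mon_ideal n {m. 1 \<le> degree_on C m} \<subseteq> Idl\<^bsub>?R\<^esub> (var ` C)"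
    proof (rule mon_ideal_subset)
      show I: "ideal (Idl\<^bsub>?R\<^esub> (var ` C)) ?R" using var by (rule genideal_ideal)
      fix m :: "nat \<Rightarrow>\<^sub>0 nat" assume m: "m \<in> {m. 1 \<le> degree_on C m}" and keys: "Poly_Mapping.keys m \<subseteq> {1..n}"
      then obtain i where i: "i \<in> C" "Poly_Mapping.lookup m i \<noteq> 0"
        by (auto simp: degree_on_def) (metis not_gr0 less_one linorder_not_less sum.neutral Suc_le_eq)
      then have "mon_dvd (Poly_Mapping.single i 1) m"
        by (auto simp: mon_dvd_def lookup_single when_def)
      then obtain a where a: "m = Poly_Mapping.single i 1 + a" by (auto simp: mon_dvd_iff)
      have "Poly_Mapping.single a 1 \<in> carrier ?R"
        using keys a by (intro carrier_single) (auto simp: keys_add_nat)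
      moreover have "(var i :: 'a mpoly) \<in> Idl\<^bsub>?R\<^esub> (var ` C)"
        using genideal_self[OF var] i(1) by blast
      ultimately have "Poly_Mapping.single a 1 * var i \<in> Idl\<^bsub>?R\<^esub> (var ` C)"
        using ideal.I_l_closed[OF I] by (auto simp: poly_ring_ops)
      then show "Poly_Mapping.single m 1 \<in> Idl\<^bsub>?R\<^esub> (var ` C)"
        by (simp add: a var_def mult_single add.commute)
    qed
  qed
qed

text \<open>A monomial of degree at least s + 1 in the variables of \<open>C\<close> contains one of
  them; splitting it off leaves degree at least s. The power 0 is the whole ring, matching the void
  condition \<open>0 \<le> degree_on C m\<close>.\<close>

lemma cover_prime_power:
  assumes C: "C \<subseteq> {1..n}"
  shows "cover_prime n C [^]\<^bsub>ideals_set (poly_ring n)\<^esub> s =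
    (mon_ideal n {m. s \<le> degree_on C m} :: ('a::field) mpoly set)"
proof -
  let ?R = "poly_ring n :: 'a mpoly ring"
  let ?I = "\<lambda>s. mon_ideal n {m. s \<le> degree_on C m} :: 'a mpoly set"
  interpret cring ?R by (rule cring_poly_ring)
  have ideal: "ideal (?I s) ?R" for s
    by (rule ideal_mon_ideal) (simp add: degree_on_add)
  have prod: "ideal_prod ?R (?I s) (?I 1) = ?I (Suc s)" for s
  proof
    show "ideal_prod ?R (?I s) (?I 1) \<subseteq> ?I (Suc s)"
    proof
      fix x assume "x \<in> ideal_prod ?R (?I s) (?I 1)"
      then show "x \<in> ?I (Suc s)"
      proof induction
        case (prod p q)
        have "Suc s \<le> degree_on C m" if "m \<in> Poly_Mapping.keys (p * q)" for m
        proof -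
          obtain a b where ab: "m = a + b" "a \<in> Poly_Mapping.keys p" "b \<in> Poly_Mapping.keys q"
            using keys_mult \<open>m \<in> _\<close> by blast
          then have "s \<le> degree_on C a" "1 \<le> degree_on C b" using prod by (auto simp: mon_ideal_def)
          then show ?thesis by (simp add: ab degree_on_add)
        qed
        then show ?case using prod by (auto simp: mon_ideal_def poly_ring_ops carrier_mult)
      next
        case (sum p q)
        then show ?case
          using keys_add[of p q] by (auto simp: mon_ideal_def poly_ring_ops carrier_add)
      qed
    qed
    show "?I (Suc s) \<subseteq> ideal_prod ?R (?I s) (?I 1)"
    proof (rule mon_ideal_subset)
      show "ideal (ideal_prod ?R (?I s) (?I 1)) ?R"
        by (intro ideal_prod_is_ideal ideal)
      fix m :: "nat \<Rightarrow>\<^sub>0 nat" assume m: "m \<in> {m. Suc s \<le> degree_on C m}" and keys: "Poly_Mapping.keys m \<subseteq> {1..n}"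
      have "\<exists>i\<in>C. Poly_Mapping.lookup m i \<noteq> 0"
      proof (rule ccontr)
        assume "\<not> ?thesis"
        then have "degree_on C m = 0" by (simp add: degree_on_def)
        then show False using m by simp
      qed
      then obtain i where i: "i \<in> C" "Poly_Mapping.lookup m i \<noteq> 0" by blast
      then have "mon_dvd (Poly_Mapping.single i 1) m"
        by (auto simp: mon_dvd_def lookup_single when_def)
      then obtain a where a: "m = Poly_Mapping.single i 1 + a" by (auto simp: mon_dvd_iff)
      have "finite C" using C finite_subset by blast
      then have d1: "degree_on C (Poly_Mapping.single i 1) = 1"
        using i(1) by (simp add: degree_on_def lookup_single when_def)
      have "Poly_Mapping.single a 1 \<in> ?I s"
        using m keys d1 by (intro single_in_mon_ideal) (auto simp: a degree_on_add keys_add_nat)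
      moreover have "Poly_Mapping.single (Poly_Mapping.single i 1) 1 \<in> ?I 1"
        using d1 C i by (intro single_in_mon_ideal) auto
      ultimately have "Poly_Mapping.single a 1 * Poly_Mapping.single (Poly_Mapping.single i 1) 1 \<in> ideal_prod ?R (?I s) (?I 1)"
        using ideal_prod.prod[of _ "?I s" _ "?I 1" ?R] by (simp add: poly_ring_ops)
      then show "Poly_Mapping.single m 1 \<in> ideal_prod ?R (?I s) (?I 1)"
        by (simp add: a mult_single add.commute)
    qed
  qed
  show ?thesis
  proof (induction s)
    case 0
    then show ?case by (auto simp: nat_pow_def ideals_set_def mon_ideal_def)
  next
    case (Suc s)
    have "cover_prime n C [^]\<^bsub>ideals_set ?R\<^esub> Suc s = ideal_prod ?R (cover_prime n C [^]\<^bsub>ideals_set ?R\<^esub> s) (cover_prime n C)"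
      by (simp add: nat_pow_def ideals_set_def)
    then show ?case using Suc prod by (simp add: cover_prime_eq[OF C])
  qed
qed

lemma minimal_vertex_cover_exists:
  assumes "vertex_cover n E C"
  shows "\<exists>D\<subseteq>C. minimal_vertex_cover n E D"
proof -
  have "finite C" using assms finite_subset by (auto simp: vertex_cover_def)
  then show ?thesis using assms
  proof (induction C rule: finite_psubset_induct)
    case (psubset C)
    show ?case
    proof (cases "minimal_vertex_cover n E C")
      case False
      then obtain D where "D \<subset> C" "vertex_cover n E D"
        using psubset.prems by (auto simp: minimal_vertex_cover_def)
      then show ?thesis using psubset.IH[of D] by blast
    qed blast
  qed
qed

text \<open>Enlarging a cover can only increase \<open>degree_on\<close>, so all covers may be used
  in place of the minimal ones. Clique complements then need no minimality check.\<close>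

lemma edge_symbolic_power_eq:
  assumes E: "simple_graph n E"
  shows "edge_symbolic_power n E s =
    (mon_ideal n {m. \<forall>C. vertex_cover n E C \<longrightarrow> s \<le> degree_on C m} :: ('a::field) mpoly set)"
proof -
  have "vertex_cover n E {1..n}"
    unfolding vertex_cover_def
  proof (intro conjI ballI)
    fix e assume "e \<in> E"
    then have "e \<subseteq> {1..n}" "card e = 2" using E by (auto simp: simple_graph_def)
    then show "e \<inter> {1..n} \<noteq> {}" by (metis card.empty inf.absorb1 zero_neq_numeral)
  qed simp
  \<comment> \<open>One minimal cover must exist: an empty intersection would be the whole type
    instead of a subset of \<open>poly_ring n\<close>.\<close>
  then obtain C0 where C0: "minimal_vertex_cover n E C0"
    using minimal_vertex_cover_exists by blast
  have iff: "(\<forall>C. vertex_cover n E C \<longrightarrow> s \<le> degree_on C m) \<longleftrightarrow>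
      (\<forall>C. minimal_vertex_cover n E C \<longrightarrow> s \<le> degree_on C m)" for m
  proof
    assume R: "\<forall>C. minimal_vertex_cover n E C \<longrightarrow> s \<le> degree_on C m"
    show "\<forall>C. vertex_cover n E C \<longrightarrow> s \<le> degree_on C m"
    proof (intro allI impI)
      fix C assume C: "vertex_cover n E C"
      then obtain D where D: "D \<subseteq> C" "minimal_vertex_cover n E D"
        using minimal_vertex_cover_exists by blast
      have "finite C" using C finite_subset by (auto simp: vertex_cover_def)
      then have "degree_on D m \<le> degree_on C m"
        unfolding degree_on_def using D(1) by (intro sum_mono2) auto
      then show "s \<le> degree_on C m" using R D(2) by force
    qed
  qed (simp add: minimal_vertex_cover_def)
  have "cover_prime n C [^]\<^bsub>ideals_set (poly_ring n)\<^esub> s = (mon_ideal n {m. s \<le> degree_on C m} :: 'a mpoly set)"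
    if "minimal_vertex_cover n E C" for C
    using that by (intro cover_prime_power) (auto simp: minimal_vertex_cover_def vertex_cover_def)
  then show ?thesis
    unfolding edge_symbolic_power_def iff using C0 by (auto simp: mon_ideal_def)
qed

text \<open>Every monomial of a homogeneous element of degree \<open>d\<close> in a monomial ideal
  is itself in the ideal and of degree \<open>d\<close>, so these monomials generate the
  component.\<close>

lemma degree_component_mon_ideal:
  assumes U: "\<And>a b. b \<in> U \<Longrightarrow> a + b \<in> U"
  shows "degree_component_ideal n d (mon_ideal n U) =
    (mon_ideal n {m. \<exists>a\<in>U. Poly_Mapping.keys a \<subseteq> {1..n} \<and> mon_deg a = d \<and> mon_dvd a m} :: ('a::field) mpoly set)"
    (is "_ = mon_ideal n ?V")
proof -
  let ?R = "poly_ring n :: 'a mpoly ring"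
  let ?S = "{p \<in> mon_ideal n U :: 'a mpoly set. homogeneous d p}"
  interpret cring ?R by (rule cring_poly_ring)
  have S: "?S \<subseteq> carrier ?R" by (auto simp: mon_ideal_def)
  show ?thesis
    unfolding degree_component_ideal_def
  proof
    show "Idl\<^bsub>?R\<^esub> ?S \<subseteq> mon_ideal n ?V"
    proof (rule genideal_minimal)
      have "a + b \<in> ?V" if b: "b \<in> ?V" for a b
      proof -
        have "mon_dvd b (a + b)" by (simp add: mon_dvd_def lookup_add)
        then show ?thesis using b mon_dvd_trans by blast
      qed
      then show "ideal (mon_ideal n ?V :: 'a mpoly set) ?R" by (rule ideal_mon_ideal)
      show "?S \<subseteq> mon_ideal n ?V"
      proof
        fix p assume p: "p \<in> ?S"
        have "m \<in> ?V" if "m \<in> Poly_Mapping.keys p" for m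
          using p that by (intro CollectI bexI[of _ m])
            (auto simp: mon_ideal_def homogeneous_def carrier_poly_ring mon_dvd_def)
        then show "p \<in> mon_ideal n ?V" using p by (auto simp: mon_ideal_def)
      qed
    qed
    show "mon_ideal n ?V \<subseteq> Idl\<^bsub>?R\<^esub> ?S"
    proof (rule mon_ideal_subset)
      show I: "ideal (Idl\<^bsub>?R\<^esub> ?S) ?R" using S by (rule genideal_ideal)
      fix m assume "m \<in> ?V" and keys: "Poly_Mapping.keys m \<subseteq> {1..n}"
      then obtain a b where a: "a \<in> U" "Poly_Mapping.keys a \<subseteq> {1..n}" "mon_deg a = d" "m = a + b"
        by (auto simp: mon_dvd_iff)
      have "(Poly_Mapping.single a 1 :: 'a mpoly) \<in> mon_ideal n U"
        using a(1,2) by (rule single_in_mon_ideal)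
      then have "Poly_Mapping.single a 1 \<in> ?S" using a(3) by (simp add: homogeneous_def)
      then have "Poly_Mapping.single a 1 \<in> Idl\<^bsub>?R\<^esub> ?S" using genideal_self[OF S] by blast
      moreover have "Poly_Mapping.single b 1 \<in> carrier ?R"
        using keys a(4) by (intro carrier_single) (auto simp: keys_add_nat)
      ultimately have "Poly_Mapping.single b 1 * Poly_Mapping.single a 1 \<in> Idl\<^bsub>?R\<^esub> ?S"
        using ideal.I_l_closed[OF I] by (auto simp: poly_ring_ops)
      then show "Poly_Mapping.single m 1 \<in> Idl\<^bsub>?R\<^esub> ?S"
        by (simp add: a(4) mult_single add.commute)
    qed
  qed
qed

section \<open>The graph\<close>

text \<open>The witnesses are the two neighbours of \<open>x\<close> on the cycle. The purpose is
  that a vertex whose neighbours on the cycle are pairwise adjacent cannot lie on a long induced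
  cycle.\<close>

lemma induced_cycle_nonadjacent_neighbours:
  assumes c: "induced_cycle n E c" "4 \<le> length c" and x: "x \<in> set c"
  shows "\<exists>y\<in>set c. \<exists>z\<in>set c. y \<noteq> z \<and> {x, y} \<in> E \<and> {x, z} \<in> E \<and> {y, z} \<notin> E"
proof -
  let ?L = "length c"
  have edge: "{c ! i, c ! j} \<in> E \<longleftrightarrow> j = Suc i \<or> (i = 0 \<and> Suc j = ?L)" if "i < j" "j < ?L" for i j
    using c(1) that by (auto simp: induced_cycle_def)
  have dist: "c ! i \<noteq> c ! j" if "i < j" "j < ?L" for i j
    using c(1) that by (simp add: induced_cycle_def nth_eq_iff_index_eq)
  obtain i where i: "i < ?L" "x = c ! i" using x by (metis in_set_conv_nth)
  have "\<exists>j k. j < k \<and> k < ?L \<and> {x, c ! j} \<in> E \<and> {x, c ! k} \<in> E \<and> {c ! j, c ! k} \<notin> E"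
  proof -
    \<comment> \<open>At either end of the list one of the two neighbours is reached through the
      closing edge between index 0 and the last index.\<close>
    consider "i = 0" | "Suc i = ?L" | "0 < i" "Suc i < ?L" using i(1) by linarith
    then show ?thesis
    proof cases
      case 1
      then show ?thesis
        using c(2) edge[of 0 1] edge[of 0 "?L - 1"] edge[of 1 "?L - 1"]
        by (intro exI[of _ 1] exI[of _ "?L - 1"]) (auto simp: i(2))
    next
      case 2
      then show ?thesis
        using c(2) edge[of 0 i] edge[of "?L - 2" i] edge[of 0 "?L - 2"]
        by (intro exI[of _ 0] exI[of _ "?L - 2"]) (auto simp: i(2) insert_commute)
    next
      case 3
      then show ?thesis
        using c(2) edge[of "i - 1" i] edge[of i "Suc i"] edge[of "i - 1" "Suc i"]
        by (intro exI[of _ "i - 1"] exI[of _ "Suc i"]) (auto simp: i(2) insert_commute)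
    qed
  qed
  then obtain j k where jk: "j < k" "k < ?L" "{x, c ! j} \<in> E" "{x, c ! k} \<in> E" "{c ! j, c ! k} \<notin> E"
    by blast
  then have "c ! j \<in> set c" "c ! k \<in> set c" "c ! j \<noteq> c ! k" using dist by auto
  then show ?thesis using jk by blast
qed

text \<open>The vertices \<open>5, 6, 7, 8\<close> are attached to the edges \<open>{1, 3}, {1, 4}, {2, 3}, {2, 4}\<close>.\<close>

definition tri_edges :: "nat set set" where
  "tri_edges = {{1,2},{1,3},{2,3},{1,4},{2,4},{1,5},{3,5},{1,6},{4,6},{2,7},{3,7},{2,8},{4,8}}"

text \<open>Both orientations are listed as ordered pairs, so that adjacency splits into equations
  for \<open>x\<close> and \<open>y\<close> instead of equations between two-element sets.\<close>

lemma tri_edges_cases: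
  assumes "{x, y} \<in> tri_edges"
  shows "(x, y) \<in> {(1,2),(1,3),(2,3),(1,4),(2,4),(1,5),(3,5),(1,6),(4,6),(2,7),(3,7),(2,8),(4,8),
     (2,1),(3,1),(3,2),(4,1),(4,2),(5,1),(5,3),(6,1),(6,4),(7,2),(7,3),(8,2),(8,4)}"
  using assms unfolding tri_edges_def by (auto simp: doubleton_eq_iff)

text \<open>A perfect elimination order: each vertex in turn has at most two adjacent neighbours
  among those not yet excluded from the cycle.\<close>

lemma chordal_tri_edges: "chordal n tri_edges"
  unfolding chordal_def
proof
  assume "\<exists>c. induced_cycle n tri_edges c \<and> 4 \<le> length c"
  then obtain c where c: "induced_cycle n tri_edges c" "4 \<le> length c" by blast
  have nb: "\<exists>y\<in>set c. \<exists>z\<in>set c. y \<noteq> z \<and> {x, y} \<in> tri_edges \<and> {x, z} \<in> tri_edges \<and> {y, z} \<notin> tri_edges"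
    if "x \<in> set c" for x
    using induced_cycle_nonadjacent_neighbours[OF c that] .
  have simplicial: "x \<notin> set c"
    if ab: "{a, b} \<in> tri_edges" and N: "\<And>y. y \<in> set c \<Longrightarrow> {x, y} \<in> tri_edges \<Longrightarrow> y = a \<or> y = b" for x a b
  proof
    assume "x \<in> set c"
    then obtain y z where "y \<noteq> z" "y = a \<or> y = b" "z = a \<or> z = b" "{y, z} \<notin> tri_edges"
      using nb N by metis
    then show False using ab by (auto simp: insert_commute)
  qed
  have e: "{1,3} \<in> tri_edges" "{1,4} \<in> tri_edges" "{2,3} \<in> tri_edges" "{2,4} \<in> tri_edges" "{1,2} \<in> tri_edges"
    by (simp_all add: tri_edges_def)
  have 5: "5 \<notin> set c" by (rule simplicial[OF e(1)]) (drule tri_edges_cases, auto)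
  have 6: "6 \<notin> set c" by (rule simplicial[OF e(2)]) (drule tri_edges_cases, auto)
  have 7: "7 \<notin> set c" by (rule simplicial[OF e(3)]) (drule tri_edges_cases, auto)
  have 8: "8 \<notin> set c" by (rule simplicial[OF e(4)]) (drule tri_edges_cases, auto)
  \<comment> \<open>With 5 and 7 excluded, the only remaining neighbours of 3 are the adjacent
    vertices 1 and 2; likewise for 4 after 6 and 8.\<close>
  have 3: "3 \<notin> set c" by (rule simplicial[OF e(5)]) (drule tri_edges_cases, use 5 7 in auto)
  have 4: "4 \<notin> set c" by (rule simplicial[OF e(5)]) (drule tri_edges_cases, use 6 8 in auto)
  have "x \<notin> set c" for x
    by (rule simplicial[OF e(5)]) (drule tri_edges_cases, use 3 4 5 6 7 8 in auto)
  then show False using c(2) by (metis list.set_intros(1) list.size(3) neq_Nil_conv not_numeral_le_zero)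
qed

text \<open>The isolated vertices of H enter only through \<open>n\<close>: the vertices from 9 on
  are adjacent to all others here.\<close>

definition tri_complement :: "nat \<Rightarrow> nat set set" where
  "tri_complement n = complement_graph n tri_edges"

lemma simple_tri_complement: "simple_graph n (tri_complement n)"
  by (auto simp: simple_graph_def tri_complement_def complement_graph_def)

lemma cochordal_tri_complement:
  assumes "8 \<le> n"
  shows "cochordal n (tri_complement n)"
proof -
  have "e \<subseteq> {1..n} \<and> card e = 2" if "e \<in> tri_edges" for e
    using that assms unfolding tri_edges_def by auto
  then have "complement_graph n (tri_complement n) = tri_edges"
    by (auto simp: tri_complement_def complement_graph_def)
  then show ?thesis by (simp add: cochordal_def chordal_tri_edges)
qed

section \<open>Vertex covers as complements of cliques\<close>

definition clique :: "nat set set \<Rightarrow> nat set \<Rightarrow> bool" where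
  "clique E K \<longleftrightarrow> (\<forall>x\<in>K. \<forall>y\<in>K. x \<noteq> y \<longrightarrow> {x, y} \<in> E)"

lemma vertex_cover_complement_clique:
  assumes "K \<subseteq> {1..n}"
  shows "vertex_cover n (tri_complement n) ({1..n} - K) \<longleftrightarrow> clique tri_edges K"
proof
  assume L: "vertex_cover n (tri_complement n) ({1..n} - K)"
  show "clique tri_edges K"
    unfolding clique_def
  proof (intro ballI impI, rule ccontr)
    fix x y assume "x \<in> K" "y \<in> K" "x \<noteq> y" "{x, y} \<notin> tri_edges"
    then have "{x, y} \<in> tri_complement n" using assms by (auto simp: tri_complement_def complement_graph_def)
    then show False using L \<open>x \<in> K\<close> \<open>y \<in> K\<close> by (auto simp: vertex_cover_def)
  qed
next
  assume R: "clique tri_edges K"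
  have "e \<inter> ({1..n} - K) \<noteq> {}" if e: "e \<in> tri_complement n" for e
  proof
    assume "e \<inter> ({1..n} - K) = {}"
    then have "e \<subseteq> K" using e by (auto simp: tri_complement_def complement_graph_def)
    moreover obtain x y where "e = {x, y}" "x \<noteq> y"
      using e by (auto simp: tri_complement_def complement_graph_def card_2_iff)
    ultimately have "e \<in> tri_edges" using R by (auto simp: clique_def)
    then show False using e by (simp add: tri_complement_def complement_graph_def)
  qed
  then show "vertex_cover n (tri_complement n) ({1..n} - K)" by (auto simp: vertex_cover_def)
qed

section \<open>Squarefree monomials and the two generators\<close>

definition sqfree_mon :: "nat set \<Rightarrow> nat \<Rightarrow>\<^sub>0 nat" where
  "sqfree_mon S = (\<Sum>i\<in>S. Poly_Mapping.single i 1)"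

lemma lookup_sqfree_mon: "finite S \<Longrightarrow> Poly_Mapping.lookup (sqfree_mon S) i = (if i \<in> S then 1 else 0)"
  by (simp add: sqfree_mon_def lookup_sum lookup_single when_def)

lemma keys_sqfree_mon: "finite S \<Longrightarrow> Poly_Mapping.keys (sqfree_mon S) = S"
  by (auto simp: in_keys_iff lookup_sqfree_mon split: if_splits)

text \<open>Exponents below a squarefree monomial are 0 or 1. Divisors of x_1...x_n thereby become
  vertex sets, and degrees become cardinalities.\<close>

lemma mon_dvd_sqfree_mon:
  assumes "finite S" "mon_dvd a (sqfree_mon S)"
  shows "a = sqfree_mon (Poly_Mapping.keys a)"
proof (rule poly_mapping_eqI)
  fix i
  have "Poly_Mapping.lookup a i \<le> Poly_Mapping.lookup (sqfree_mon S) i"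
    using assms(2) by (simp add: mon_dvd_def)
  also have "\<dots> \<le> 1" using assms(1) by (simp add: lookup_sqfree_mon)
  finally show "Poly_Mapping.lookup a i = Poly_Mapping.lookup (sqfree_mon (Poly_Mapping.keys a)) i"
    by (simp add: lookup_sqfree_mon in_keys_iff)
qed

lemma degree_on_sqfree_mon: "finite S \<Longrightarrow> finite C \<Longrightarrow> degree_on C (sqfree_mon S) = card (C \<inter> S)"
  by (simp add: degree_on_def lookup_sqfree_mon sum.If_cases)

lemma mon_deg_sqfree_mon: "finite S \<Longrightarrow> mon_deg (sqfree_mon S) = card S"
  by (simp add: mon_deg_def keys_sqfree_mon lookup_sqfree_mon)

text \<open>Removing \<open>P\<close> leaves a bipartite graph, and a bipartite graph has no
  triangle.\<close>

lemma clique_card_le: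
  assumes K: "clique tri_edges K" and P: "P = {1, 2} \<or> P = {3, 4}"
  shows "card (K - P) \<le> 2"
proof (rule ccontr)
  have bipartite: "\<exists>Q. \<forall>x y. {x, y} \<in> tri_edges \<longrightarrow> x \<notin> P \<longrightarrow> y \<notin> P \<longrightarrow> (x \<in> Q \<longleftrightarrow> y \<notin> Q)"
    using P
  proof
    assume "P = {1, 2}"
    then show ?thesis
      \<comment> \<open>Without 1 and 2 there remain two stars, with centres 3 and 4.\<close>
      by (intro exI[of _ "{3, 4}"] allI impI) (drule tri_edges_cases, auto)
  next
    assume "P = {3, 4}"
    then show ?thesis
      \<comment> \<open>Without 3 and 4 there remains a tree: the edge between 1 and 2, the leaves 5
        and 6 at 1, and the leaves 7 and 8 at 2.\<close>
      by (intro exI[of _ "{1, 7, 8}"] allI impI) (drule tri_edges_cases, auto)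
  qed
  assume "\<not> ?thesis"
  then have "3 \<le> card (K - P)" by simp
  then obtain D where D: "D \<subseteq> K - P" "card D = 3" by (rule obtain_subset_with_card_n)
  then obtain x y z where xyz: "D = {x, y, z}" "x \<noteq> y" "x \<noteq> z" "y \<noteq> z"
    unfolding card_3_iff by blast
  then have "{x, y} \<in> tri_edges" "{y, z} \<in> tri_edges" "{x, z} \<in> tri_edges"
    using K D(1) unfolding clique_def by blast+
  moreover obtain Q where "\<And>x y. {x, y} \<in> tri_edges \<Longrightarrow> x \<notin> P \<Longrightarrow> y \<notin> P \<Longrightarrow> x \<in> Q \<longleftrightarrow> y \<notin> Q"
    using bipartite by blast
  ultimately show False
    using D(1) unfolding xyz(1) by blast
qed

text \<open>The support has s + 2 elements, and a cover misses only a clique, which meets the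
  support in at most two of them.\<close>

lemma sqfree_mon_in_symbolic_power:
  assumes P: "P = {1, 2} \<or> P = {3, 4}" and C: "vertex_cover (s + 4) (tri_complement (s + 4)) C"
  shows "s \<le> degree_on C (sqfree_mon ({1..s + 4} - P))"
proof -
  define K where "K = {1..s + 4} - C"
  have C_sub: "C \<subseteq> {1..s + 4}" using C by (simp add: vertex_cover_def)
  then have CK: "C = {1..s + 4} - K" by (auto simp: K_def)
  have "clique tri_edges K"
    using C vertex_cover_complement_clique[of K "s + 4"] unfolding CK by (auto simp: K_def)
  then have "card (K - P) \<le> 2" using P by (rule clique_card_le)
  moreover have "card ({1..s + 4} - P) = s + 2"
    using P by (subst card_Diff_subset) auto
  moreover have "{1..s + 4} - P = (C \<inter> ({1..s + 4} - P)) \<union> (K - P)" using C_sub by (auto simp: K_def)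
  then have "card ({1..s + 4} - P) \<le> card (C \<inter> ({1..s + 4} - P)) + card (K - P)"
    by (metis card_Un_le)
  ultimately have "s \<le> card (C \<inter> ({1..s + 4} - P))" by linarith
  moreover have "finite C" using C_sub finite_subset by blast
  ultimately show ?thesis by (simp add: degree_on_sqfree_mon)
qed

text \<open>If a second variable beyond x_1, x_2 were absent, the support would be the complement of
  {p, i} with \<open>i\<close> at least 3 and would contain an outer triangle; the complementary
  cover then sees degree s - 1 only.\<close>

lemma generators_avoiding_one_or_two:
  assumes s: "4 \<le> s" and p: "p = 1 \<or> p = 2"
    and a: "\<And>C. vertex_cover (s + 4) (tri_complement (s + 4)) C \<Longrightarrow> s \<le> degree_on C a"
    and deg: "mon_deg a = s + 2" and dvd: "mon_dvd a (sqfree_mon {1..s + 4})"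
    and ap: "Poly_Mapping.lookup a p = 0"
  shows "mon_dvd (sqfree_mon ({1..s + 4} - {1, 2})) a"
proof (rule ccontr)
  assume "\<not> ?thesis"
  then obtain i where "i \<in> {1..s + 4} - {1, 2}" "Poly_Mapping.lookup a i = 0"
    by (fastforce simp: mon_dvd_def lookup_sqfree_mon split: if_splits)
  then have i: "i \<in> {3..s + 4}" "Poly_Mapping.lookup a i = 0" by auto
  define S where "S = Poly_Mapping.keys a"
  have aS: "a = sqfree_mon S" unfolding S_def using dvd by (intro mon_dvd_sqfree_mon) auto
  have "S \<subseteq> {1..s + 4}"
    using mon_dvd_keys[OF dvd] by (simp add: S_def keys_sqfree_mon)
  then have S_sub: "S \<subseteq> {1..s + 4} - {p, i}"
    using ap i(2) by (auto simp: S_def in_keys_iff)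
  have "finite S" by (simp add: S_def)
  then have "card S = s + 2" using deg mon_deg_sqfree_mon[of S] by (simp add: aS[symmetric])
  moreover have "card ({1..s + 4} - {p, i}) = s + 2"
    using p i(1) by (subst card_Diff_subset) auto
  ultimately have S_eq: "S = {1..s + 4} - {p, i}"
    using S_sub by (intro card_subset_eq) auto
  \<comment> \<open>Of 1 and 2, take the one different from \<open>p\<close>. Its two outer
    triangles avoid \<open>p\<close> and share only that vertex, so \<open>i\<close> lies on at most
    one of them.\<close>
  have "\<exists>K. clique tri_edges K \<and> card K = 3 \<and> K \<subseteq> {1..8} - {p, i}"
  proof -
    have "clique tri_edges {2, 3, 7}" "clique tri_edges {2, 4, 8}" "clique tri_edges {1, 3, 5}" "clique tri_edges {1, 4, 6}"
      by (auto simp: clique_def tri_edges_def insert_commute)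
    moreover have "{2, 3, 7} \<subseteq> {1..8} - {1, i} \<or> {2, 4, 8} \<subseteq> {1..8} - {1, i}"
        "{1, 3, 5} \<subseteq> {1..8} - {2, i} \<or> {1, 4, 6} \<subseteq> {1..8} - {2, i}"
      using i(1) by auto
    moreover have "card {2, 3, 7 :: nat} = 3" "card {2, 4, 8 :: nat} = 3" "card {1, 3, 5 :: nat} = 3" "card {1, 4, 6 :: nat} = 3"
      by simp_all
    ultimately show ?thesis using p by metis
  qed
  then obtain K where K: "clique tri_edges K" "card K = 3" "K \<subseteq> {1..8} - {p, i}" by blast
  have "finite K" using K(3) finite_subset by blast
  have "{1..8} \<subseteq> {1..s + 4}" using s by auto
  then have K_sub: "K \<subseteq> {1..s + 4} - {p, i}" using K(3) by blast
  have "s \<le> degree_on ({1..s + 4} - K) a"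
    using vertex_cover_complement_clique[of K "s + 4"] K(1) K_sub by (intro a) auto
  also have "\<dots> = card (({1..s + 4} - {p, i}) - K)"
    unfolding aS S_eq using K_sub by (subst degree_on_sqfree_mon) (auto intro: arg_cong[where f = card])
  also have "\<dots> = s + 2 - 3"
    using \<open>card ({1..s + 4} - {p, i}) = s + 2\<close> K(2) K_sub \<open>finite K\<close> by (simp add: card_Diff_subset)
  finally show False using s by simp
qed

section \<open>The first syzygy and the conclusion\<close>

text \<open>Existence of a resolution makes the one selected by \<open>SOME\<close> genuine, and the
  nonvanishing criterion holds for every resolution. The separation hypothesis becomes a condition
  on exponents alone.\<close>

theorem betti_one_mon_ideal_nonzero:
  assumes W: "\<And>a b. b \<in> W \<Longrightarrow> a + b \<in> W" and X: "Poly_Mapping.keys X \<subseteq> {1..n}"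
    and sep: "\<And>Y. mon_dvd Y X \<Longrightarrow> Y \<noteq> X \<Longrightarrow>
      (\<forall>b\<in>W. mon_dvd b Y \<longrightarrow> b \<in> T) \<or> (\<forall>b\<in>W. mon_dvd b Y \<longrightarrow> b \<notin> T)"
    and u: "u \<in> W" "mon_dvd u X" "u \<noteq> X" "u \<in> T"
    and v: "v \<in> W" "mon_dvd v X" "v \<noteq> X" "v \<notin> T"
  shows "betti n (mon_ideal n W :: ('a::field) mpoly set) 1 (mon_deg X) \<noteq> 0"
proof -
  let ?M = "mon_ideal n W :: 'a mpoly set"
  have "\<exists>F. graded_free_resolution n ?M F"
    using ideal_mon_ideal[OF W] restr_mon_ideal by (rule graded_free_resolution_exists)
  then have F: "graded_free_resolution n ?M (SOME F. graded_free_resolution n ?M F)"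
    by (rule someI_ex)
  have keys: "Poly_Mapping.keys u \<subseteq> {1..n}" "Poly_Mapping.keys v \<subseteq> {1..n}"
    using X mon_dvd_keys u(2) v(2) by blast+
  have "(\<forall>p\<in>?M. \<forall>b\<in>Poly_Mapping.keys p. mon_dvd b Y \<longrightarrow> b \<in> T) \<or>
      (\<forall>p\<in>?M. \<forall>b\<in>Poly_Mapping.keys p. mon_dvd b Y \<longrightarrow> b \<notin> T)"
    if "mon_dvd Y X" "Y \<noteq> X" for Y
    using sep[OF that] by (auto simp: mon_ideal_def)
  then show ?thesis
    unfolding betti_def
    using u v by (intro tor_dim_one_nonzero[OF F X, of T u v] single_in_mon_ideal keys) auto
qed

theorem proposition6p4:
  fixes s :: nat
  assumes "4 \<le> s"
  shows "\<exists>n E. simple_graph n E \<and> cochordal n E \<and>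
           \<not> componentwise_linear n (edge_symbolic_power n E s :: ('a::field) mpoly set) \<and>
           regularity n (degree_component_ideal n (s + 2)
             (edge_symbolic_power n E s :: 'a mpoly set)) \<ge> ereal (real (s + 3))"
proof -
  define n where "n = s + 4"
  define E where "E = tri_complement n"
  define U where "U = {m. \<forall>C. vertex_cover n E C \<longrightarrow> s \<le> degree_on C m}"
  define W where "W = {m. \<exists>a\<in>U. Poly_Mapping.keys a \<subseteq> {1..n} \<and> mon_deg a = s + 2 \<and> mon_dvd a m}"
  have L: "edge_symbolic_power n E s = (mon_ideal n U :: 'a mpoly set)"
    unfolding U_def E_def by (rule edge_symbolic_power_eq[OF simple_tri_complement])
  have "a + b \<in> U" if b: "b \<in> U" for a b
    using b unfolding U_def by (auto simp: degree_on_add intro: trans_le_add2)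
  then have M: "degree_component_ideal n (s + 2) (mon_ideal n U) = (mon_ideal n W :: 'a mpoly set)"
    unfolding W_def by (rule degree_component_mon_ideal)
  define X where "X = sqfree_mon {1..n}"
  define u where "u = sqfree_mon ({1..n} - {1, 2})"
  define v where "v = sqfree_mon ({1..n} - {3, 4})"
  have keysX: "Poly_Mapping.keys X \<subseteq> {1..n}" by (simp add: X_def keys_sqfree_mon)
  have degX: "mon_deg X = s + 4" by (simp add: X_def mon_deg_sqfree_mon n_def)
  have gen: "sqfree_mon ({1..n} - P) \<in> W \<and> mon_dvd (sqfree_mon ({1..n} - P)) X"
    if P: "P = {1, 2} \<or> P = {3, 4}" for P
  proof -
    have "sqfree_mon ({1..n} - P) \<in> U"
      using sqfree_mon_in_symbolic_power[OF P] by (auto simp: U_def E_def n_def)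
    moreover have "card ({1..n} - P) = s + 2"
      using P assms by (subst card_Diff_subset) (auto simp: n_def)
    moreover have "mon_dvd m m" for m by (simp add: mon_dvd_def)
    ultimately have "sqfree_mon ({1..n} - P) \<in> W"
      unfolding W_def by (intro CollectI bexI[of _ "sqfree_mon ({1..n} - P)"])
        (auto simp: mon_deg_sqfree_mon keys_sqfree_mon)
    then show ?thesis by (auto simp: mon_dvd_def X_def lookup_sqfree_mon)
  qed
  have uW: "u \<in> W" "mon_dvd u X" and vW: "v \<in> W" "mon_dvd v X"
    using gen[of "{1, 2}"] gen[of "{3, 4}"] by (simp_all add: u_def v_def)
  have at3: "Poly_Mapping.lookup X 3 = 1" "Poly_Mapping.lookup u 3 = 1" "Poly_Mapping.lookup v 3 = 0"
    and at1: "Poly_Mapping.lookup X 1 = 1" "Poly_Mapping.lookup u 1 = 0"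
    using assms by (simp_all add: X_def u_def v_def lookup_sqfree_mon n_def)
  have uvX: "u \<noteq> X" "v \<noteq> X" using at3 at1 by auto
  \<comment> \<open>The separating set consists of the multiples of \<open>u\<close>. A proper
    divisor of \<open>X\<close> lacks some variable: if it is x_1 or x_2, every generator below it
    is \<open>u\<close>; otherwise the variable occurs in \<open>u\<close>, which therefore divides
    nothing below.\<close>
  have sep: "(\<forall>b\<in>W. mon_dvd b Y \<longrightarrow> b \<in> {b. mon_dvd u b}) \<or> (\<forall>b\<in>W. mon_dvd b Y \<longrightarrow> b \<notin> {b. mon_dvd u b})"
    if Y: "mon_dvd Y X" "Y \<noteq> X" for Y
  proof (cases "\<exists>p. (p = 1 \<or> p = 2) \<and> Poly_Mapping.lookup Y p = 0")
    case True
    then obtain p where p: "p = 1 \<or> p = 2" "Poly_Mapping.lookup Y p = 0" by blast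
    have "mon_dvd u b" if b: "b \<in> W" "mon_dvd b Y" for b
    proof -
      obtain a where a: "a \<in> U" "mon_deg a = s + 2" "mon_dvd a b" using b(1) by (auto simp: W_def)
      then have aY: "mon_dvd a Y" using b(2) mon_dvd_trans by blast
      then have "Poly_Mapping.lookup a p = 0" using p(2) by (metis mon_dvd_def le_zero_eq)
      moreover have "mon_dvd a X" using aY Y(1) by (rule mon_dvd_trans)
      ultimately have "mon_dvd u a"
        using generators_avoiding_one_or_two[OF assms p(1) _ a(2)] a(1)
        unfolding u_def X_def U_def E_def n_def by blast
      then show ?thesis using a(3) by (rule mon_dvd_trans)
    qed
    then show ?thesis by blast
  next
    case False
    have "\<exists>i. Poly_Mapping.lookup Y i < Poly_Mapping.lookup X i"
    proof (rule ccontr)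
      assume "\<not> ?thesis"
      then have "mon_dvd X Y" by (simp add: mon_dvd_def not_less)
      then show False using Y mon_dvd_antisym by blast
    qed
    then obtain i where i: "Poly_Mapping.lookup Y i < Poly_Mapping.lookup X i" ..
    then have "i \<in> {1..n}" and Yi: "Poly_Mapping.lookup Y i = 0"
      by (auto simp: X_def lookup_sqfree_mon split: if_splits)
    moreover have "i \<noteq> 1" "i \<noteq> 2" using False Yi by auto
    ultimately have "Poly_Mapping.lookup u i = 1" by (simp add: u_def lookup_sqfree_mon)
    then have "\<not> mon_dvd u b" if "mon_dvd b Y" for b
      using that Yi by (metis mon_dvd_def le_zero_eq zero_neq_one)
    then show ?thesis by blast
  qed
  have "a + b \<in> W" if b: "b \<in> W" for a b
  proof -
    have "mon_dvd b (a + b)" by (simp add: mon_dvd_def lookup_add)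
    then show ?thesis using b mon_dvd_trans unfolding W_def by blast
  qed
  moreover have "u \<in> {b. mon_dvd u b}" "v \<notin> {b. mon_dvd u b}"
    using at3 by (auto simp: mon_dvd_def intro!: exI[of _ 3])
  ultimately have betti: "betti n (mon_ideal n W :: 'a mpoly set) 1 (s + 4) \<noteq> 0"
    using betti_one_mon_ideal_nonzero[OF _ keysX sep uW uvX(1) _ vW uvX(2)] degX by metis
  \<comment> \<open>Excludes the alternative in \<open>componentwise_linear\<close> that the
    component ideal is zero.\<close>
  have "(Poly_Mapping.single u 1 :: 'a mpoly) \<in> mon_ideal n W"
    using uW keysX mon_dvd_keys by (blast intro: single_in_mon_ideal)
  moreover have "(Poly_Mapping.single u 1 :: 'a mpoly) \<noteq> 0"
    by (metis lookup_single_eq lookup_zero zero_neq_one)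
  ultimately have "(mon_ideal n W :: 'a mpoly set) \<noteq> {0}" by blast
  \<comment> \<open>Linearity would put all first syzygies in degree s + 3, while one sits in degree
    s + 4; the same Betti number gives regularity at least (s + 4) - 1.\<close>
  moreover have "\<not> has_linear_resolution n (s + 2) (mon_ideal n W :: 'a mpoly set)"
    unfolding has_linear_resolution_def using betti by (intro notI) (auto dest!: spec[of _ 1] spec[of _ "s + 4"])
  ultimately have "\<not> componentwise_linear n (edge_symbolic_power n E s :: 'a mpoly set)"
    unfolding componentwise_linear_def L using M by metis
  moreover have "ereal (real (s + 3)) \<le> regularity n (degree_component_ideal n (s + 2) (edge_symbolic_power n E s :: 'a mpoly set))"
    unfolding L M regularity_def
  proof (rule Sup_upper)
    show "ereal (real (s + 3)) \<in> {ereal (real j - real i) |i j. betti n (mon_ideal n W :: 'a mpoly set) i j \<noteq> 0}"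
      using betti by (intro CollectI exI[of _ 1] exI[of _ "s + 4"]) simp
  qed
  moreover have "cochordal n E"
    unfolding E_def using assms by (intro cochordal_tri_complement) (simp add: n_def)
  ultimately show ?thesis
    using simple_tri_complement unfolding E_def by blast
qed

end
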